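(* Let $S$ be a semitopological semigroup. Then $WAP(S)$ has a multiplicative left invariant mean if and only if the following fixed point property holds: every separately continuous and quasi-equicontinuous representation of $S$ on a nonempty compact Hausdorff space $K$ has a common fixed point in $K$, i.e. a point $x\in K$ with $T_s(x)=x$ for all $s\in S$.
   Context: A semitopological semigroup is a semigroup $S$ with a Hausdorff topology such that for each $t\in S$ the maps $s\mapsto ts$ and $s\mapsto st$ are continuous. $C_b(S)$ is the space of bounded continuous complex-valued functions on $S$ with sup norm; $(\ell_sf)(t)=f(st)$. $WAP(S)$ is the set of $f\in C_b(S)$ such that $\{\ell_sf:s\in S\}$ is relatively compact in the weak topology of $C_b(S)$; it is a translation invariant closed subalgebra of $C_b(S)$ containing the constants. A mean on $WAP(S)$ is a linear functional $m\in WAP(S)^*$ with $\|m\|=m(1)=1$; it is left invariant if $m(\ell_sf)=m(f)$ for all $s\in S$, $f\in WAP(S)$, and multiplicative if $m(fg)=m(f)m(g)$ for all $f,g\in WAP(S)$. A representation of $S$ on $K$ is a family $\{T_s:s\in S\}$ of mappings $T_s:K\to K$ with $T_{st}=T_s\circ T_t$ for $s,t\in S$. It is separately continuous if $(s,x)\mapsto T_s(x)$, $S\times K\to K$, is separately continuous. It is quasi-equicontinuous if the closure of $\{T_s:s\in S\}$ in the product space $K^K$ consists entirely of continuous mappings. *)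

theory Defs
  imports "HOL-Analysis.Analysis"
begin

class semitopological_semigroup = semigroup_mult + t2_space +
  assumes open_vimage_left_mult: "open U \<Longrightarrow> open ((\<lambda>s. t * s) -` U)"
    and open_vimage_right_mult: "open U \<Longrightarrow> open ((\<lambda>s. s * t) -` U)"

lemma continuous_on_left_mult:
  "continuous_on UNIV (\<lambda>s. t * s)" for t :: "'a::semitopological_semigroup"
  by (simp add: continuous_on_open_vimage open_vimage_left_mult)

lemma continuous_on_right_mult:
  "continuous_on UNIV (\<lambda>s. s * t)" for t :: "'a::semitopological_semigroup"
  by (simp add: continuous_on_open_vimage open_vimage_right_mult)

text \<open>
  The library makes \<^typ>\<open>'a \<Rightarrow>\<^sub>C complex\<close> a real normed space under the sup norm; its
  complex scalar multiplication and pointwise product are supplied here.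
\<close>

unbundle bcontfun.lifting

lift_definition scaleC_bcontfun ::
  "complex \<Rightarrow> ('a::topological_space \<Rightarrow>\<^sub>C complex) \<Rightarrow> ('a \<Rightarrow>\<^sub>C complex)"
  is "\<lambda>c f x. c * f x"
proof -
  fix c :: complex and f :: "'a \<Rightarrow> complex"
  assume "f \<in> bcontfun"
  then have cont: "continuous_on UNIV f" and "bounded (range f)"
    by (auto simp: bcontfun_def)
  then obtain b where "\<And>x. norm (f x) \<le> b"
    unfolding bounded_iff by blast
  then have "norm (c * f x) \<le> norm c * b" for x
    unfolding norm_mult by (intro mult_left_mono norm_ge_zero)
  then show "(\<lambda>x. c * f x) \<in> bcontfun"
    by (intro bcontfun_normI[where b = "norm c * b"] continuous_on_mult continuous_on_const cont)
qed

lift_definition mult_bcontfun ::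
  "('a::topological_space \<Rightarrow>\<^sub>C complex) \<Rightarrow> ('a \<Rightarrow>\<^sub>C complex) \<Rightarrow> ('a \<Rightarrow>\<^sub>C complex)"
  is "\<lambda>f g x. f x * g x"
proof -
  fix f g :: "'a \<Rightarrow> complex"
  assume "f \<in> bcontfun" and "g \<in> bcontfun"
  then have cont: "continuous_on UNIV f" "continuous_on UNIV g"
    and bdd: "bounded (range f)" "bounded (range g)"
    by (auto simp: bcontfun_def)
  from bdd(1) obtain a where a: "\<And>x. norm (f x) \<le> a"
    unfolding bounded_iff by blast
  from bdd(2) obtain b where b: "\<And>x. norm (g x) \<le> b"
    unfolding bounded_iff by blast
  have "norm (f x * g x) \<le> a * b" for x
    unfolding norm_mult
    by (rule mult_mono[OF a b order_trans[OF norm_ge_zero a] norm_ge_zero])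
  then show "(\<lambda>x. f x * g x) \<in> bcontfun"
    by (intro bcontfun_normI[where b = "a * b"] continuous_on_mult cont)
qed

lift_definition left_translate ::
  "'a::semitopological_semigroup \<Rightarrow> ('a \<Rightarrow>\<^sub>C complex) \<Rightarrow> ('a \<Rightarrow>\<^sub>C complex)"
  is "\<lambda>s f t. f (s * t)"
proof -
  fix s :: 'a and f :: "'a \<Rightarrow> complex"
  assume "f \<in> bcontfun"
  then have cont: "continuous_on UNIV f" and bdd: "bounded (range f)"
    by (simp_all add: bcontfun_def)
  have "continuous_on UNIV (\<lambda>t. f (s * t))"
    by (rule continuous_on_compose2[OF cont continuous_on_left_mult subset_UNIV])
  moreover have "bounded (range (\<lambda>t. f (s * t)))"
    by (rule bounded_subset[OF bdd]) blast
  ultimately show "(\<lambda>t. f (s * t)) \<in> bcontfun"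
    by (simp add: bcontfun_def)
qed

definition complex_dual :: "(('a::topological_space \<Rightarrow>\<^sub>C complex) \<Rightarrow> complex) set" where
  "complex_dual =
     {\<phi>. bounded_linear \<phi> \<and> (\<forall>c f. \<phi> (scaleC_bcontfun c f) = c * \<phi> f)}"

definition weak_topology :: "('a::topological_space \<Rightarrow>\<^sub>C complex) topology" where
  "weak_topology = topology_generated_by {\<phi> -` U | \<phi> U. \<phi> \<in> complex_dual \<and> open U}"

definition WAP :: "('a::semitopological_semigroup \<Rightarrow>\<^sub>C complex) set" where
  "WAP = {f. compactin weak_topology (weak_topology closure_of range (\<lambda>s. left_translate s f))}"

text \<open>
  A functional on \<^const>\<open>WAP\<close> is a function on all of \<^typ>\<open>'a \<Rightarrow>\<^sub>C complex\<close> of which only the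
  values on \<^const>\<open>WAP\<close> are ever constrained.
\<close>

definition linear_on_WAP ::
  "(('a::semitopological_semigroup \<Rightarrow>\<^sub>C complex) \<Rightarrow> complex) \<Rightarrow> bool" where
  "linear_on_WAP m \<longleftrightarrow>
     (\<forall>f\<in>WAP. \<forall>g\<in>WAP. m (f + g) = m f + m g) \<and>
     (\<forall>c. \<forall>f\<in>WAP. m (scaleC_bcontfun c f) = c * m f)"

text \<open>Boundedness is stated separately because \<open>Sup\<close> on the reals is unspecified on unbounded sets.\<close>

definition is_mean :: "(('a::semitopological_semigroup \<Rightarrow>\<^sub>C complex) \<Rightarrow> complex) \<Rightarrow> bool" where
  "is_mean m \<longleftrightarrow>
     linear_on_WAP m \<and>
     bdd_above {cmod (m f) | f. f \<in> WAP \<and> norm f \<le> 1} \<and>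
     Sup {cmod (m f) | f. f \<in> WAP \<and> norm f \<le> 1} = 1 \<and>
     m (const_bcontfun 1) = 1"

definition left_invariant :: "(('a::semitopological_semigroup \<Rightarrow>\<^sub>C complex) \<Rightarrow> complex) \<Rightarrow> bool"
  where "left_invariant m \<longleftrightarrow> (\<forall>s. \<forall>f\<in>WAP. m (left_translate s f) = m f)"

definition multiplicative :: "(('a::semitopological_semigroup \<Rightarrow>\<^sub>C complex) \<Rightarrow> complex) \<Rightarrow> bool"
  where "multiplicative m \<longleftrightarrow> (\<forall>f\<in>WAP. \<forall>g\<in>WAP. m (mult_bcontfun f g) = m f * m g)"

definition representation ::
  "'k topology \<Rightarrow> ('a::semitopological_semigroup \<Rightarrow> 'k \<Rightarrow> 'k) \<Rightarrow> bool" where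
  "representation K T \<longleftrightarrow>
     (\<forall>s. T s \<in> topspace K \<rightarrow> topspace K) \<and>
     (\<forall>s t. \<forall>x\<in>topspace K. T (s * t) x = T s (T t x))"

definition separately_continuous ::
  "'k topology \<Rightarrow> ('a::semitopological_semigroup \<Rightarrow> 'k \<Rightarrow> 'k) \<Rightarrow> bool" where
  "separately_continuous K T \<longleftrightarrow>
     (\<forall>s. continuous_map K K (T s)) \<and>
     (\<forall>x\<in>topspace K. continuous_map euclidean K (\<lambda>s. T s x))"

text \<open>
  Points of the library's product space are extensional functions, hence the restriction
  of each \<open>T s\<close> to the carrier of \<open>K\<close>.
\<close>

definition quasi_equicontinuous ::
  "'k topology \<Rightarrow> ('a::semitopological_semigroup \<Rightarrow> 'k \<Rightarrow> 'k) \<Rightarrow> bool" where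
  "quasi_equicontinuous K T \<longleftrightarrow>
     (\<forall>g \<in> product_topology (\<lambda>_. K) (topspace K) closure_of
              range (\<lambda>s. restrict (T s) (topspace K)).
        continuous_map K K g)"

text \<open>
  The fixed point property for all compact Hausdorff spaces whose points are drawn from the
  type \<^typ>\<open>'k\<close>. HOL cannot quantify over types inside a formula, so the type is a parameter.
\<close>

definition fixed_point_property ::
  "'a::semitopological_semigroup itself \<Rightarrow> 'k itself \<Rightarrow> bool" where
  "fixed_point_property _ _ \<longleftrightarrow>
     (\<forall>(K :: 'k topology) (T :: 'a \<Rightarrow> 'k \<Rightarrow> 'k).
        compact_space K \<and> Hausdorff_space K \<and> topspace K \<noteq> {} \<and>
        representation K T \<and> separately_continuous K T \<and> quasi_equicontinuous K T
        \<longrightarrow> (\<exists>x\<in>topspace K. \<forall>s. T s x = x))"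

end

theory Submission
  imports Defs
begin

text \<open>
  Given a mean \<open>m\<close> and a base point \<open>x0\<close>, every continuous \<open>h\<close> on \<open>K\<close> yields the function
  \<open>t \<mapsto> h (T t x0)\<close> on the semigroup. It is weakly almost periodic, because its translates lie
  in the image of the compact closure of the maps \<open>T s\<close>, and this closure is mapped continuously
  into the weak topology. Hence \<open>m\<close> induces a character of \<open>C(K)\<close>, which is evaluation at a point,
  and left invariance makes that point fixed.

  Continuity into the weak topology is Grothendieck's theorem that pointwise compact bounded sets of
  continuous functions are weakly compact. It is proved without measures. The total variation of a
  functional is a modular functional on nonnegative continuous functions, so if it is bounded
  below along a sequence then, as in Arzela's bounded convergence theorem, infinitely many members
  of the sequence are large at one point. A sequence chosen as in Eberlein's argument then
  contradicts separate continuity at a pair of cluster points.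

  Conversely, the semigroup acts by translation on the closure of the point evaluations,
  restricted to \<^const>\<open>WAP\<close>; weak compactness of orbits gives separate continuity and
  quasi-equicontinuity, and a fixed point is a multiplicative left invariant mean.
\<close>

section \<open>Bounded convergence for functionals on continuous functions\<close>

text \<open>For continuous \<open>a\<close> \<ge> 0 this is the total variation of \<rho> evaluated
  at \<open>a\<close>. No absolute value is taken, because the admissible \<open>h\<close> are
  closed under negation.\<close>

definition dominated_sup ::
  "(('a::topological_space \<Rightarrow>\<^sub>C 'b::real_normed_vector) \<Rightarrow> real) \<Rightarrow> ('a \<Rightarrow> real) \<Rightarrow> real" where
  "dominated_sup \<rho> a = Sup {\<rho> h | h. \<forall>t. norm (apply_bcontfun h t) \<le> a t}"

lemma bdd_above_dominated:
  fixes \<rho> :: "('a::topological_space \<Rightarrow>\<^sub>C 'b::real_normed_vector) \<Rightarrow> real"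
  assumes "bounded_linear \<rho>" and "\<And>t. a t \<le> C"
  shows "bdd_above {\<rho> h | h. \<forall>t. norm (apply_bcontfun h t) \<le> a t}"
proof -
  obtain B where B: "0 < B" "\<And>h. norm (\<rho> h) \<le> norm h * B"
    using bounded_linear.pos_bounded[OF assms(1)] by blast
  have "\<rho> h \<le> C * B" if "\<forall>t. norm (apply_bcontfun h t) \<le> a t" for h
  proof -
    have "norm h \<le> C"
      using that assms(2) by (meson norm_bound order_trans)
    then have "norm h * B \<le> C * B"
      using B(1) by simp
    then show ?thesis
      using B(2)[of h] by simp
  qed
  then show ?thesis
    by (auto simp: bdd_above_def)
qed

lemma dominated_sup_upper:
  assumes "bounded_linear \<rho>" and "\<And>t. a t \<le> C" and "\<And>t. norm (apply_bcontfun h t) \<le> a t"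
  shows "\<rho> h \<le> dominated_sup \<rho> a"
  unfolding dominated_sup_def
  by (rule cSup_upper[OF _ bdd_above_dominated[OF assms(1,2)]]) (use assms(3) in auto)

lemma dominated_sup_least:
  assumes "\<And>t. 0 \<le> a t"
    and "\<And>h. (\<And>t. norm (apply_bcontfun h t) \<le> a t) \<Longrightarrow> \<rho> h \<le> z"
  shows "dominated_sup \<rho> a \<le> z"
  unfolding dominated_sup_def
proof (rule cSup_least)
  have "\<forall>t. norm (apply_bcontfun (0 :: 'a \<Rightarrow>\<^sub>C 'b) t) \<le> a t"
    using assms(1) by simp
  then show "{\<rho> h | h. \<forall>t. norm (apply_bcontfun h t) \<le> a t} \<noteq> {}"
    by blast
qed (use assms(2) in auto)

lemma dominated_sup_mono:
  assumes "bounded_linear \<rho>" and "\<And>t. 0 \<le> a t" and "\<And>t. a t \<le> b t" and "\<And>t. b t \<le> C"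
  shows "dominated_sup \<rho> a \<le> dominated_sup \<rho> b"
  by (intro dominated_sup_least dominated_sup_upper[where C = C])
    (use assms order_trans in blast)+

lemma dominated_sup_le:
  assumes "\<And>h. norm (\<rho> h) \<le> norm h * B" and "0 \<le> B" and "\<And>t. 0 \<le> a t" and "\<And>t. a t \<le> C"
  shows "dominated_sup \<rho> a \<le> C * B"
proof (rule dominated_sup_least[OF assms(3)])
  fix h :: "'a \<Rightarrow>\<^sub>C 'b"
  assume "\<And>t. norm (apply_bcontfun h t) \<le> a t"
  then have "norm h \<le> C"
    using assms(4) by (meson norm_bound order_trans)
  then have "norm h * B \<le> C * B"
    using assms(2) by (simp add: mult_right_mono)
  then show "\<rho> h \<le> C * B"
    using assms(1)[of h] by simp
qed

text \<open>
  A function bounded by \<open>a + b = min a b + max a b\<close> is split by retracting its values to the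
  ball of radius \<open>max a b\<close>.
\<close>

lemma dominated_sup_min_max:
  fixes \<rho> :: "('a::topological_space \<Rightarrow>\<^sub>C 'b::real_normed_vector) \<Rightarrow> real"
  assumes lin: "bounded_linear \<rho>"
    and cont: "continuous_on UNIV a" "continuous_on UNIV b"
    and pos: "\<And>t. 0 < a t" "\<And>t. 0 < b t"
    and bdd: "\<And>t. a t \<le> C" "\<And>t. b t \<le> C"
  shows "dominated_sup \<rho> a + dominated_sup \<rho> b \<le>
         dominated_sup \<rho> (\<lambda>t. min (a t) (b t)) + dominated_sup \<rho> (\<lambda>t. max (a t) (b t))"
    (is "_ \<le> ?z")
proof -
  interpret bounded_linear \<rho> by (rule lin)
  have *: "\<rho> h1 + \<rho> h2 \<le> ?z"
    if h1: "\<And>t. norm (apply_bcontfun h1 t) \<le> a t" and h2: "\<And>t. norm (apply_bcontfun h2 t) \<le> b t" for h1 h2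
  proof -
    define M where "M t = max (a t) (b t)" for t
    define k where "k = h1 + h2"
    \<comment> \<open>The factor is 1 where \<open>k\<close> has norm at most \<open>M\<close> and
      cuts the norm down to \<open>M\<close> elsewhere. Positivity of \<open>M\<close> keeps the
      denominator nonzero, so \<open>r\<close> is continuous.\<close>
    define r where "r t = (M t / max (M t) (norm (apply_bcontfun k t))) *\<^sub>R apply_bcontfun k t" for t
    have M_pos: "0 < M t" for t
      using pos by (simp add: M_def less_max_iff_disj)
    have r_le: "norm (r t) \<le> M t" for t
      using M_pos[of t] by (simp add: r_def field_simps)
    have "continuous_on UNIV (apply_bcontfun k)"
      by simp
    moreover have "max (M t) (norm (apply_bcontfun k t)) \<noteq> 0" for t
      using M_pos[of t] by linarith
    ultimately have "continuous_on UNIV r"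
      unfolding r_def M_def by (intro continuous_intros cont) (auto simp: M_def)
    then have "r \<in> bcontfun"
      by (rule bcontfun_normI[where b = C]) (use r_le bdd in \<open>simp add: M_def; meson order_trans max.boundedI\<close>)
    then have app: "apply_bcontfun (Bcontfun r) t = r t" for t
      by (simp add: Bcontfun_inverse)
    have k_le: "norm (apply_bcontfun k t) \<le> a t + b t" for t
      using h1[of t] h2[of t] norm_triangle_ineq[of "h1 t" "h2 t"] by (simp add: k_def)
    have "norm (apply_bcontfun (k - Bcontfun r) t) \<le> min (a t) (b t)" for t
    proof -
      let ?q = "M t / max (M t) (norm (apply_bcontfun k t))"
      have "apply_bcontfun (k - Bcontfun r) t = (1 - ?q) *\<^sub>R apply_bcontfun k t"
        by (simp add: app r_def scaleR_left_diff_distrib)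
      moreover have "0 \<le> 1 - ?q"
        using M_pos[of t] by (simp add: field_simps)
      ultimately have "norm (apply_bcontfun (k - Bcontfun r) t) = (1 - ?q) * norm (apply_bcontfun k t)"
        by simp
      \<comment> \<open>The remainder only carries the excess of the norm of \<open>k\<close> over
        \<open>M\<close>, and a + b - max a b = min a b.\<close>
      also have "\<dots> \<le> max 0 (norm (apply_bcontfun k t) - M t)"
        using M_pos[of t] by (auto simp: max_def field_simps)
      also have "\<dots> \<le> min (a t) (b t)"
        using k_le[of t] pos[of t] by (auto simp: M_def)
      finally show ?thesis .
    qed
    then have "\<rho> (k - Bcontfun r) \<le> dominated_sup \<rho> (\<lambda>t. min (a t) (b t))"
      by (intro dominated_sup_upper[where C = C] lin) (use bdd in \<open>auto intro: min.coboundedI1\<close>)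
    moreover have "\<rho> (Bcontfun r) \<le> dominated_sup \<rho> (\<lambda>t. max (a t) (b t))"
      by (intro dominated_sup_upper[where C = C] lin) (use bdd r_le in \<open>auto simp: app M_def\<close>)
    moreover have "\<rho> h1 + \<rho> h2 = \<rho> (k - Bcontfun r) + \<rho> (Bcontfun r)"
      by (simp add: k_def diff add)
    ultimately show ?thesis by linarith
  qed
  \<comment> \<open>The two suprema are taken one at a time: over \<open>h1\<close> with
    \<open>h2\<close> fixed, then over \<open>h2\<close>.\<close>
  have "dominated_sup \<rho> a \<le> ?z - \<rho> h2" if "\<And>t. norm (apply_bcontfun h2 t) \<le> b t" for h2
    using *[OF _ that] by (intro dominated_sup_least) (auto simp: less_imp_le pos le_diff_eq)
  then have "dominated_sup \<rho> b \<le> ?z - dominated_sup \<rho> a"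
    by (intro dominated_sup_least) (auto simp: less_imp_le pos le_diff_eq, smt (verit, best))
  then show ?thesis by simp
qed

lemma continuous_on_Max_image:
  fixes f :: "'i \<Rightarrow> 'a::topological_space \<Rightarrow> real"
  assumes "finite I" "I \<noteq> {}" "\<And>i. i \<in> I \<Longrightarrow> continuous_on A (f i)"
  shows "continuous_on A (\<lambda>x. Max ((\<lambda>i. f i x) ` I))"
  using assms by (induction rule: finite_ne_induct) (auto intro!: continuous_on_max)

lemma continuous_on_Min_image:
  fixes f :: "'i \<Rightarrow> 'a::topological_space \<Rightarrow> real"
  assumes "finite I" "I \<noteq> {}" "\<And>i. i \<in> I \<Longrightarrow> continuous_on A (f i)"
  shows "continuous_on A (\<lambda>x. Min ((\<lambda>i. f i x) ` I))"
  using assms by (induction rule: finite_ne_induct) (auto intro!: continuous_on_min)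

text \<open>Functional form of the fact that a limsup of sets of measure at least \<epsilon> has
  positive measure. Maxima over windows {k..k + N k} nearly exhaust the variation of the tail from
  \<open>k\<close>; modularity shows that the minimum of finitely many such maxima still has
  variation above \<epsilon>/2, so it cannot be uniformly small. The bounds \<open>N k\<close> do
  not depend on \<open>n\<close>, which is what later permits passage to a cluster point.\<close>

lemma bounded_functional_simultaneously_large:
  fixes \<rho> :: "('a::topological_space \<Rightarrow>\<^sub>C 'b::real_normed_vector) \<Rightarrow> real"
    and f :: "nat \<Rightarrow> 'a \<Rightarrow> real"
  assumes lin: "bounded_linear \<rho>"
    and cont: "\<And>j. continuous_on UNIV (f j)"
    and nonneg: "\<And>j t. 0 \<le> f j t"
    and bdd: "\<And>j t. f j t \<le> C"
    and "0 < \<epsilon>"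
    and large: "\<And>j. \<exists>h. (\<forall>t. norm (apply_bcontfun h t) \<le> f j t) \<and> \<epsilon> \<le> \<rho> h"
  shows "\<exists>\<delta>>0. \<exists>N. \<forall>n. \<exists>t. \<forall>k\<le>n. \<exists>j\<in>{k..N k}. \<delta> \<le> f j t"
proof -
  obtain B where B: "0 < B" "\<And>h. norm (\<rho> h) \<le> norm h * B"
    using bounded_linear.pos_bounded[OF lin] by blast
  \<comment> \<open>A function bounded by 2\<delta> has variation at most 2\<delta>B = \<epsilon>/4,
    below the \<epsilon>/2 that will be retained. One of the two \<delta> pays for the shift in
    \<open>F\<close>.\<close>
  define \<delta> where "\<delta> = \<epsilon> / (8 * B)"
  have \<delta>: "0 < \<delta>" "2 * \<delta> * B = \<epsilon> / 4"
    using B(1) \<open>0 < \<epsilon>\<close> by (auto simp: \<delta>_def)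
  \<comment> \<open>The shift makes all functions strictly positive, as
    \<open>dominated_sup_min_max\<close> requires.\<close>
  define F where "F j t = f j t + \<delta>" for j t
  define D where "D = C + \<delta>"
  let ?\<Lambda> = "dominated_sup \<rho>"
  define s where "s k N t = Max ((\<lambda>j. F j t) ` {k..k + N})" for k N t
  have F: "0 < F j t" "F j t \<le> D" for j t
    using nonneg[of j t] bdd[of j t] \<delta>(1) by (auto simp: F_def D_def)
  have s_cont: "continuous_on UNIV (s k N)" for k N
    unfolding s_def F_def by (intro continuous_on_Max_image continuous_intros cont) auto
  have s_pos: "0 < s k N t" for k N t
    unfolding s_def by (subst Max_gr_iff) (use F in auto)
  have s_le: "s k N t \<le> D" for k N t
    unfolding s_def by (subst Max_le_iff) (use F in auto)
  have s_mono: "s k N t \<le> s k' N' t" if "k' \<le> k" "k + N \<le> k' + N'" for k N k' N' t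
    unfolding s_def by (rule Max_mono) (use that in auto)
  have \<Lambda>_s: "?\<Lambda> (s k N) \<le> D * B" for k N
    by (rule dominated_sup_le[OF B(2)]) (use B(1) s_pos s_le in \<open>auto intro: less_imp_le\<close>)
  define L where "L k = (SUP N. ?\<Lambda> (s k N))" for k
  have bdd_L: "bdd_above (range (\<lambda>N. ?\<Lambda> (s k N)))" for k
    using \<Lambda>_s by (auto simp: bdd_above_def)
  have L_upper: "?\<Lambda> (s k N) \<le> L k" for k N
    unfolding L_def by (rule cSUP_upper[OF _ bdd_L]) simp
  have L_ge: "\<epsilon> \<le> L k" for k
  proof -
    obtain h where h: "\<And>t. norm (apply_bcontfun h t) \<le> f k t" "\<epsilon> \<le> \<rho> h"
      using large by blast
    have "norm (apply_bcontfun h t) \<le> s k 0 t" for t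
      using h(1)[of t] \<delta>(1) by (simp add: s_def F_def)
    then have "\<rho> h \<le> ?\<Lambda> (s k 0)"
      by (intro dominated_sup_upper[OF lin s_le])
    with h(2) L_upper[of k 0] show ?thesis by linarith
  qed
  have "\<exists>N. L k - \<epsilon> / 2 ^ (k + 2) < ?\<Lambda> (s k N)" for k
  proof -
    have "L k - \<epsilon> / 2 ^ (k + 2) < L k"
      using \<open>0 < \<epsilon>\<close> by simp
    then show ?thesis
      unfolding L_def by (subst (asm) less_cSUP_iff[OF _ bdd_L]) auto
  qed
  then obtain N where N: "\<And>k. L k - \<epsilon> / 2 ^ (k + 2) < ?\<Lambda> (s k (N k))"
    by metis
  define m where "m n t = Min ((\<lambda>k. s k (N k) t) ` {..n})" for n t
  have m_cont: "continuous_on UNIV (m n)" for n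
    unfolding m_def by (intro continuous_on_Min_image s_cont) auto
  have m_pos: "0 < m n t" for n t
    unfolding m_def by (subst Min_gr_iff) (use s_pos in auto)
  have m_le: "m n t \<le> s k (N k) t" if "k \<le> n" for n k t
    unfolding m_def by (rule Min_le) (use that in auto)
  have m_Suc: "m (Suc n) = (\<lambda>t. min (m n t) (s (Suc n) (N (Suc n)) t))" for n
    by (rule ext) (simp add: m_def atMost_Suc min.commute)
  \<comment> \<open>The subtracted \<epsilon>/2 - \<epsilon>/2^(n+2) is exactly the sum of the
    errors up to index \<open>n\<close>.\<close>
  have \<Lambda>_m: "L n - \<epsilon> / 2 + \<epsilon> / 2 ^ (n + 2) \<le> ?\<Lambda> (m n)" for n
  proof (induction n)
    case 0
    have "m 0 = s 0 (N 0)"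
      by (rule ext) (simp add: m_def)
    with N[of 0] show ?case by simp
  next
    case (Suc n)
    let ?s = "s (Suc n) (N (Suc n))"
    have "?\<Lambda> (m n) + ?\<Lambda> ?s \<le> ?\<Lambda> (m (Suc n)) + ?\<Lambda> (\<lambda>t. max (m n t) (?s t))"
      unfolding m_Suc
      by (rule dominated_sup_min_max[OF lin m_cont s_cont m_pos s_pos _ s_le])
        (use m_le s_le order_trans in blast)
    \<comment> \<open>The maximum lives on a window that starts at \<open>n\<close>, so its
      variation is at most \<open>L n\<close>; this cancels the \<open>L n\<close> of the induction
      hypothesis and leaves \<open>L (Suc n)\<close>.\<close>
    moreover have "?\<Lambda> (\<lambda>t. max (m n t) (?s t)) \<le> ?\<Lambda> (s n (N n + N (Suc n) + 1))"
    proof (rule dominated_sup_mono[OF lin _ _ s_le])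
      fix t
      show "0 \<le> max (m n t) (?s t)"
        using m_pos[of n t] by linarith
      have "m n t \<le> s n (N n) t"
        by (rule m_le) simp
      also have "\<dots> \<le> s n (N n + N (Suc n) + 1) t"
        by (rule s_mono) auto
      finally show "max (m n t) (?s t) \<le> s n (N n + N (Suc n) + 1) t"
        using s_mono[of n "Suc n" "N (Suc n)" "N n + N (Suc n) + 1" t] by simp
    qed
    ultimately have "?\<Lambda> (m (Suc n)) \<ge> ?\<Lambda> (m n) + ?\<Lambda> ?s - L n"
      using L_upper[of n "N n + N (Suc n) + 1"] by linarith
    moreover have "\<epsilon> / 2 ^ (n + 2) - \<epsilon> / 2 ^ (Suc n + 2) = \<epsilon> / 2 ^ (Suc n + 2)"
      by (simp add: field_simps)
    ultimately show ?case
      using Suc.IH N[of "Suc n"] by linarith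
  qed
  have "\<exists>t. \<forall>k\<le>n. \<exists>j\<in>{k..k + N k}. \<delta> \<le> f j t" for n
  proof -
    have "\<exists>t. 2 * \<delta> < m n t"
    proof (rule ccontr)
      assume "\<nexists>t. 2 * \<delta> < m n t"
      then have "?\<Lambda> (m n) \<le> 2 * \<delta> * B"
        by (intro dominated_sup_le[OF B(2)]) (use B(1) m_pos in \<open>auto simp: not_less intro: less_imp_le\<close>)
      moreover have "\<epsilon> / 2 < ?\<Lambda> (m n)"
        using \<Lambda>_m[of n] L_ge[of n] \<open>0 < \<epsilon>\<close>
        by (smt (verit) divide_pos_pos field_sum_of_halves zero_less_power)
      ultimately show False
        using \<delta>(2) \<open>0 < \<epsilon>\<close> by linarith
    qed
    then obtain t where t: "2 * \<delta> < m n t" ..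
    have "\<exists>j\<in>{k..k + N k}. \<delta> \<le> f j t" if "k \<le> n" for k
    proof -
      have "2 * \<delta> < s k (N k) t"
        using t m_le[OF that, of t] by linarith
      then obtain j where "j \<in> {k..k + N k}" "2 * \<delta> < F j t"
        unfolding s_def by (subst (asm) Max_gr_iff) auto
      then show ?thesis
        by (intro bexI[of _ j]) (auto simp: F_def)
    qed
    then show ?thesis by blast
  qed
  with \<delta>(1) show ?thesis
    by (intro exI[of _ \<delta>] conjI exI[of _ "\<lambda>k. k + N k"]) auto
qed

section \<open>Functionals applied to separately continuous families\<close>

text \<open>The point lies in the closure of every tail. The second conclusion is the form in which
  it is used: closed conditions that hold eventually pass to the cluster point, without any
  convergent subsequence.\<close>

lemma compact_space_cluster_point:
  assumes "compact_space X" and "\<And>n::nat. u n \<in> topspace X"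
  obtains z where "z \<in> topspace X"
    and "\<And>C n. \<lbrakk>closedin X C; \<And>m. n \<le> m \<Longrightarrow> u m \<in> C\<rbrakk> \<Longrightarrow> z \<in> C"
proof -
  let ?E = "\<lambda>n. X closure_of (u ` {n..})"
  have "\<Inter> (range ?E) \<noteq> {}"
  proof (rule compact_space_imp_nest[OF assms(1)])
    show "?E n \<noteq> {}" for n
      using assms(2) by (subst closure_of_eq_empty) (auto simp: image_subset_iff)
    show "decseq ?E"
      by (auto simp: decseq_def intro!: closure_of_mono)
  qed auto
  then obtain z where z: "\<And>n. z \<in> ?E n"
    by blast
  show thesis
  proof
    show "z \<in> topspace X"
      using z closure_of_subset_topspace by fast
    show "z \<in> C" if "closedin X C" "\<And>m. n \<le> m \<Longrightarrow> u m \<in> C" for C n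
      using z[of n] closure_of_minimal[of "u ` {n..}" C X] that by (auto simp: image_subset_iff)
  qed
qed

text \<open>Total boundedness of the image of \<open>X\<close> under the finite family
  \<open>P\<close>. Summing the deviations lets one continuous function describe each member of the
  cover.\<close>

lemma compact_space_finite_net:
  fixes f :: "'p \<Rightarrow> 'x \<Rightarrow> 'b::real_normed_vector"
  assumes "compact_space X" and "finite P" and "\<And>p. p \<in> P \<Longrightarrow> continuous_map X euclidean (f p)"
    and "0 < e"
  obtains Q where "finite Q" and "Q \<subseteq> topspace X"
    and "\<And>x. x \<in> topspace X \<Longrightarrow> \<exists>q\<in>Q. \<forall>p\<in>P. norm (f p x - f p q) < e"
proof -
  define U where "U q = {x \<in> topspace X. (\<Sum>p\<in>P. norm (f p x - f p q)) \<in> {..<e}}" for q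
  have "openin X (U q)" for q
    unfolding U_def
    by (rule openin_continuous_map_preimage[where Y = euclideanreal])
      (auto intro!: continuous_intros assms)
  moreover have "topspace X \<subseteq> \<Union> (U ` topspace X)"
    using \<open>0 < e\<close> by (auto simp: U_def)
  ultimately obtain F where F: "finite F" "F \<subseteq> U ` topspace X" "topspace X \<subseteq> \<Union> F"
    using assms(1) unfolding compact_space_alt by (metis (no_types, lifting) image_iff)
  then obtain Q where Q: "finite Q" "Q \<subseteq> topspace X" "F = U ` Q"
    by (meson finite_subset_image)
  show thesis
  proof
    fix x assume "x \<in> topspace X"
    then obtain q where q: "q \<in> Q" "(\<Sum>p\<in>P. norm (f p x - f p q)) < e"
      using F(3) Q(3) by (auto simp: U_def)
    then have "norm (f p x - f p q) < e" if "p \<in> P" for p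
      using member_le_sum[OF that, of "\<lambda>p. norm (f p x - f p q)"] \<open>finite P\<close> by fastforce
    with q(1) show "\<exists>q\<in>Q. \<forall>p\<in>P. norm (f p x - f p q) < e"
      by blast
  qed (use Q in auto)
qed

text \<open>Grothendieck's theorem by a double limit argument. If continuity fails at
  \<open>g0\<close>, points \<open>g n\<close> far from \<open>g0\<close> under \<phi> are chosen
  together with finite nets \<open>Q n\<close> of \<open>X\<close>. The differences
  \<open>D (g n)\<close> are small on the nets, yet infinitely many are at least \<delta> at a
  single \<open>x\<close>. Replacing \<open>x\<close> by a cluster point \<open>z\<close> of net
  points and taking a cluster point \<gamma> of the large \<open>g j\<close> yields both norm (D
  \<gamma> z) \<ge> \<delta> and D \<gamma> z = 0.\<close>

theorem continuous_map_functional_separately_continuous: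
  fixes \<rho> :: "('a::topological_space \<Rightarrow>\<^sub>C 'b::real_normed_vector) \<Rightarrow> real"
    and H :: "'g \<Rightarrow> 'x \<Rightarrow> 'b"
  assumes lin: "bounded_linear \<rho>"
    and G: "compact_space G" and X: "compact_space X"
    and H1: "\<And>x. x \<in> topspace X \<Longrightarrow> continuous_map G euclidean (\<lambda>g. H g x)"
    and H2: "\<And>g. g \<in> topspace G \<Longrightarrow> continuous_map X euclidean (H g)"
    and bdd: "\<And>g x. \<lbrakk>g \<in> topspace G; x \<in> topspace X\<rbrakk> \<Longrightarrow> norm (H g x) \<le> C"
    and p: "continuous_map euclidean X p"
  shows "continuous_map G euclidean (\<lambda>g. \<rho> (Bcontfun (\<lambda>t. H g (p t))))"
proof (rule ccontr)
  interpret bounded_linear \<rho> by (rule lin)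
  define \<phi> where "\<phi> g = \<rho> (Bcontfun (\<lambda>t. H g (p t)))" for g
  have p_in: "p t \<in> topspace X" for t
    using p by (auto simp: continuous_map_def)
  have bc: "(\<lambda>t. H g (p t)) \<in> bcontfun" if "g \<in> topspace G" for g
  proof (rule bcontfun_normI)
    show "continuous_on UNIV (\<lambda>t. H g (p t))"
      using continuous_map_compose[OF p H2[OF that]] by (simp add: o_def)
  qed (use bdd that p_in in blast)
  assume "\<not> continuous_map G euclidean (\<lambda>g. \<rho> (Bcontfun (\<lambda>t. H g (p t))))"
  then have "\<not> continuous_map G euclidean \<phi>"
    by (simp add: \<phi>_def[abs_def])
  then obtain g0 \<epsilon> where g0: "g0 \<in> topspace G" and "0 < \<epsilon>"
    and far: "\<And>U. \<lbrakk>openin G U; g0 \<in> U\<rbrakk> \<Longrightarrow> \<exists>g\<in>U. \<epsilon> \<le> \<bar>\<phi> g - \<phi> g0\<bar>"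
    unfolding mtopology_is_euclidean[symmetric] Met_TC.continuous_map_to_metric
    by (auto simp: dist_real_def abs_minus_commute not_less)
  define D where "D g x = H g x - H g0 x" for g x
  have D1: "continuous_map G euclidean (\<lambda>g. D g x)" if "x \<in> topspace X" for x
    unfolding D_def using that by (intro continuous_intros H1) auto
  have D2: "continuous_map X euclidean (D g)" if "g \<in> topspace G" for g
    unfolding D_def using that g0 by (intro continuous_intros H2)
  \<comment> \<open>A state holds the current point, the finite set of earlier points and the
    current net.\<close>
  define ok where "ok = (\<lambda>(n::nat) (g, P, Q). g \<in> topspace G \<and> \<epsilon> \<le> \<bar>\<phi> g - \<phi> g0\<bar> \<and>
    finite P \<and> P \<subseteq> topspace G \<and> finite Q \<and> Q \<subseteq> topspace X)"
  \<comment> \<open>The new net approximates every point of \<open>X\<close> with respect to all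
    points chosen so far, and the next point is then nearly equal to \<open>g0\<close> on this
    net.\<close>
  define step where "step = (\<lambda>(n::nat) (g, P, Q) (g', P', Q'). P' = insert g P \<and> Q \<subseteq> Q' \<and>
    (\<forall>x\<in>topspace X. \<exists>q\<in>Q'. \<forall>i\<in>P'. norm (D i x - D i q) < 1 / Suc n) \<and>
    (\<forall>q\<in>Q'. norm (D g' q) < 1 / Suc n))"
  have "\<exists>st. \<forall>n. ok n (st n) \<and> step n (st n) (st (Suc n))"
  proof (rule dependent_nat_choice)
    show "\<exists>x. ok 0 x"
      using far[of "topspace G"] g0 by (auto simp: ok_def intro!: exI[of _ "{}"])
    show "\<exists>y. ok (Suc n) y \<and> step n x y" if "ok n x" for x n
    proof -
      obtain g P Q where x: "x = (g, P, Q)"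
        by (metis prod_cases3)
      with that have *: "g \<in> topspace G" "finite P" "P \<subseteq> topspace G" "finite Q" "Q \<subseteq> topspace X"
        by (auto simp: ok_def)
      obtain R where R: "finite R" "R \<subseteq> topspace X"
        "\<And>x. x \<in> topspace X \<Longrightarrow> \<exists>q\<in>R. \<forall>i\<in>insert g P. norm (D i x - D i q) < 1 / Suc n"
        by (rule compact_space_finite_net[OF X, of "insert g P" D "1 / Suc n"])
          (use * D2 in auto)
      define U where "U = {g \<in> topspace G. (\<Sum>q\<in>Q \<union> R. norm (D g q)) \<in> {..<1 / Suc n}}"
      have "openin G U"
        unfolding U_def
        by (rule openin_continuous_map_preimage[where Y = euclideanreal])
          (use * R in \<open>auto intro!: continuous_intros D1\<close>)
      moreover have "g0 \<in> U"
        using g0 by (simp add: U_def D_def)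
      ultimately obtain g' where g': "g' \<in> U" "\<epsilon> \<le> \<bar>\<phi> g' - \<phi> g0\<bar>"
        using far by blast
      have "norm (D g' q) < 1 / Suc n" if "q \<in> Q \<union> R" for q
        using member_le_sum[OF that, of "\<lambda>q. norm (D g' q)"] g'(1) *(4) R(1)
        by (simp add: U_def)
      moreover have "\<exists>q\<in>Q \<union> R. \<forall>i\<in>insert g P. norm (D i x - D i q) < 1 / Suc n"
        if "x \<in> topspace X" for x
        using R(3)[OF that] by blast
      ultimately have "ok (Suc n) (g', insert g P, Q \<union> R) \<and> step n x (g', insert g P, Q \<union> R)"
        using * R(1,2) g' by (simp add: ok_def step_def x U_def)
      then show ?thesis ..
    qed
  qed
  then obtain st where st: "\<And>n. ok n (st n)" "\<And>n. step n (st n) (st (Suc n))"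
    by blast
  define g where "g n = fst (st n)" for n
  define P where "P n = fst (snd (st n))" for n
  define Q where "Q n = snd (snd (st n))" for n
  have st_eq: "st n = (g n, P n, Q n)" for n
    by (simp add: g_def P_def Q_def)
  have g: "g n \<in> topspace G" "\<epsilon> \<le> \<bar>\<phi> (g n) - \<phi> g0\<bar>" and Q_sub: "Q n \<subseteq> topspace X" for n
    using st(1)[of n] by (auto simp: ok_def st_eq)
  have step: "P (Suc n) = insert (g n) (P n)" "Q n \<subseteq> Q (Suc n)"
    "\<And>x. x \<in> topspace X \<Longrightarrow> \<exists>q\<in>Q (Suc n). \<forall>i\<in>P (Suc n). norm (D i x - D i q) < 1 / Suc n"
    "\<And>q. q \<in> Q (Suc n) \<Longrightarrow> norm (D (g (Suc n)) q) < 1 / Suc n" for n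
    using st(2)[of n] by (auto simp: step_def st_eq)
  have g_in_P: "g i \<in> P (Suc n)" if "i \<le> n" for i n
    using that by (induction n) (auto simp: step(1) le_Suc_eq)
  have Q_mono: "Q m \<subseteq> Q n" if "m \<le> n" for m n
    using lift_Suc_mono_le[of Q m n] step(2) that by blast

  \<comment> \<open>Changing the sign of the difference, if needed, makes the functional positive
    without affecting the norms.\<close>
  have "\<exists>h. (\<forall>t. norm (apply_bcontfun h t) \<le> norm (D (g j) (p t))) \<and> \<epsilon> \<le> \<rho> h" for j
  proof -
    let ?h = "Bcontfun (\<lambda>t. H (g j) (p t)) - Bcontfun (\<lambda>t. H g0 (p t))"
    have app: "apply_bcontfun ?h t = D (g j) (p t)" for t
      by (simp add: D_def Bcontfun_inverse bc g g0)
    have "\<rho> ?h = \<phi> (g j) - \<phi> g0"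
      by (simp add: \<phi>_def diff)
    then have "\<epsilon> \<le> \<rho> ?h \<or> \<epsilon> \<le> \<rho> (- ?h)"
      using g(2)[of j] unfolding neg by linarith
    then show ?thesis
      using app by (metis (no_types, lifting) norm_minus_cancel order_refl uminus_bcontfun.rep_eq)
  qed
  moreover have "continuous_on UNIV (\<lambda>t. norm (D (g j) (p t)))" for j
    using continuous_map_compose[OF p D2[OF g(1)[of j]]]
    by (intro continuous_on_norm) (simp add: o_def)
  moreover have "norm (D (g j) (p t)) \<le> 2 * C" for j t
    using bdd[OF g(1)[of j] p_in[of t]] bdd[OF g0 p_in[of t]]
      norm_triangle_ineq4[of "H (g j) (p t)" "H g0 (p t)"] by (simp add: D_def)
  ultimately obtain \<delta> N where "0 < \<delta>"
    and "\<And>n. \<exists>t. \<forall>k\<le>n. \<exists>j\<in>{k..N k}. \<delta> \<le> norm (D (g j) (p t))"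
    using bounded_functional_simultaneously_large
      [OF lin, of "\<lambda>j t. norm (D (g j) (p t))" "2 * C" \<epsilon>] \<open>0 < \<epsilon>\<close> norm_ge_zero by metis
  then obtain t where t: "\<And>n k. k \<le> n \<Longrightarrow> \<exists>j\<in>{k..N k}. \<delta> \<le> norm (D (g j) (p (t n)))"
    by metis
  have closed_X: "closedin X {x \<in> topspace X. \<delta> \<le> norm (D (g j) x)}" for j
    using closedin_continuous_map_preimage[OF continuous_map_norm[OF D2[OF g(1)[of j]]], of "{\<delta>..}"]
    by simp
  obtain x where x: "x \<in> topspace X"
    "\<And>C n. \<lbrakk>closedin X C; \<And>m. n \<le> m \<Longrightarrow> p (t m) \<in> C\<rbrakk> \<Longrightarrow> x \<in> C"
    by (rule compact_space_cluster_point[OF X, of "\<lambda>n. p (t n)"]) (use p_in in auto)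
  \<comment> \<open>For fixed \<open>k\<close>, all \<open>p (t n)\<close> with n \<ge> k lie in one
    finite union of closed sets, so \<open>x\<close> lies in it too.\<close>
  have "\<exists>j\<ge>k. \<delta> \<le> norm (D (g j) x)" for k
  proof -
    have "x \<in> (\<Union>j\<in>{k..N k}. {x \<in> topspace X. \<delta> \<le> norm (D (g j) x)})"
    proof (rule x(2))
      show "closedin X (\<Union>j\<in>{k..N k}. {x \<in> topspace X. \<delta> \<le> norm (D (g j) x)})"
        by (rule closedin_Union) (use closed_X in auto)
    qed (use t p_in in blast)
    then show ?thesis by auto
  qed
  then obtain j where j: "\<And>k. k \<le> j k" "\<And>k. \<delta> \<le> norm (D (g (j k)) x)"
    by metis
  \<comment> \<open>\<open>y n\<close> is a net point imitating \<open>x\<close> on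
    \<open>g 0\<close>, ..., \<open>g n\<close>; its cluster point therefore agrees with
    \<open>x\<close> on every \<open>g i\<close>.\<close>
  obtain y where y: "\<And>n. y n \<in> Q (Suc n)"
    "\<And>n i. i \<in> P (Suc n) \<Longrightarrow> norm (D i x - D i (y n)) < 1 / Suc n"
    using step(3)[OF x(1)] by metis
  have y_in: "y n \<in> topspace X" for n
    using y(1)[of n] Q_sub by blast
  obtain z where z: "z \<in> topspace X"
    "\<And>C n. \<lbrakk>closedin X C; \<And>m. n \<le> m \<Longrightarrow> y m \<in> C\<rbrakk> \<Longrightarrow> z \<in> C"
    by (rule compact_space_cluster_point[OF X, of y]) (use y_in in auto)
  have Dz: "D (g i) z = D (g i) x" for i
  proof -
    have "norm (D (g i) x - D (g i) z) \<le> 1 / Suc n" for n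
    proof -
      have "z \<in> {z \<in> topspace X. norm (D (g i) x - D (g i) z) \<in> {..1 / Suc n}}"
      proof (rule z(2)[of _ "max i n"])
        show "closedin X {z \<in> topspace X. norm (D (g i) x - D (g i) z) \<in> {..1 / Suc n}}"
          by (rule closedin_continuous_map_preimage[where Y = euclideanreal])
            (use D2[OF g(1)[of i]] in \<open>auto intro!: continuous_intros\<close>)
        fix m assume m: "max i n \<le> m"
        then have "norm (D (g i) x - D (g i) (y m)) < 1 / Suc m"
          by (intro y(2) g_in_P) simp
        also have "\<dots> \<le> 1 / Suc n"
          using m by (intro divide_left_mono) auto
        finally show "y m \<in> {z \<in> topspace X. norm (D (g i) x - D (g i) z) \<in> {..1 / Suc n}}"
          using y_in by simp
      qed
      then show ?thesis by simp
    qed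
    then have "norm (D (g i) x - D (g i) z) \<le> 0"
      by (metis LIMSEQ_le_const Suc_eq_plus1 LIMSEQ_inverse_real_of_nat inverse_eq_divide)
    then show ?thesis by simp
  qed
  obtain \<gamma> where \<gamma>: "\<gamma> \<in> topspace G"
    "\<And>C n. \<lbrakk>closedin G C; \<And>m. n \<le> m \<Longrightarrow> g (j m) \<in> C\<rbrakk> \<Longrightarrow> \<gamma> \<in> C"
    by (rule compact_space_cluster_point[OF G, of "\<lambda>n. g (j n)"]) (use g in auto)
  \<comment> \<open>The first order of limits: continuity in the first variable at the fixed point
    \<open>z\<close>, where \<open>D (g (j m))\<close> has the same value as at
    \<open>x\<close>.\<close>
  have "\<gamma> \<in> {g \<in> topspace G. norm (D g z) \<in> {\<delta>..}}"
  proof (rule \<gamma>(2))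
    show "closedin G {g \<in> topspace G. norm (D g z) \<in> {\<delta>..}}"
      by (rule closedin_continuous_map_preimage[where Y = euclideanreal])
        (use D1[OF z(1)] in \<open>auto intro!: continuous_intros\<close>)
  qed (use g j Dz in auto)
  \<comment> \<open>The second order of limits: \<open>D \<gamma>\<close> vanishes at each net point
    \<open>y n\<close>, hence at their cluster point.\<close>
  moreover have "z \<in> {z \<in> topspace X. D \<gamma> z \<in> {0}}"
  proof (rule z(2))
    show "closedin X {z \<in> topspace X. D \<gamma> z \<in> {0}}"
      by (rule closedin_continuous_map_preimage[OF D2[OF \<gamma>(1)]]) auto
    show "y n \<in> {z \<in> topspace X. D \<gamma> z \<in> {0}}" for n
    proof -
      have "norm (D \<gamma> (y n)) \<le> 1 / Suc k" for k
      proof -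
        have "\<gamma> \<in> {g \<in> topspace G. norm (D g (y n)) \<in> {..1 / Suc k}}"
        \<comment> \<open>The offset forces \<open>j m\<close> to be a successor
          \<open>Suc l\<close> with l \<ge> n: \<open>step\<close> bounds \<open>g (Suc l)\<close>
          on \<open>Q (Suc l)\<close>, and this net contains \<open>y n\<close>.\<close>
        proof (rule \<gamma>(2)[of _ "Suc (max n k)"])
          show "closedin G {g \<in> topspace G. norm (D g (y n)) \<in> {..1 / Suc k}}"
            by (rule closedin_continuous_map_preimage[where Y = euclideanreal])
              (use D1[OF y_in[of n]] in \<open>auto intro!: continuous_intros\<close>)
          fix m assume "Suc (max n k) \<le> m"
          with j(1)[of m] obtain l where l: "j m = Suc l" "n \<le> l" "k \<le> l"
            by (cases "j m") auto
          then have "y n \<in> Q (Suc l)"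
            using y(1) Q_mono by (meson Suc_le_mono subsetD)
          then have "norm (D (g (Suc l)) (y n)) < 1 / Suc l"
            by (rule step(4))
          also have "\<dots> \<le> 1 / Suc k"
            using l by (intro divide_left_mono) auto
          finally show "g (j m) \<in> {g \<in> topspace G. norm (D g (y n)) \<in> {..1 / Suc k}}"
            using g(1) l(1) by simp
        qed
        then show ?thesis by simp
      qed
      then have "norm (D \<gamma> (y n)) \<le> 0"
        by (metis LIMSEQ_le_const Suc_eq_plus1 LIMSEQ_inverse_real_of_nat inverse_eq_divide)
      with y_in show ?thesis by simp
    qed
  qed
  ultimately show False
    using \<open>0 < \<delta>\<close> by simp
qed

section \<open>The fixed point obtained from a mean\<close>

lemma zero_in_complex_dual: "(\<lambda>_. 0) \<in> complex_dual"
  by (simp add: complex_dual_def bounded_linear_zero)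

lemma apply_in_complex_dual: "(\<lambda>f. apply_bcontfun f t) \<in> complex_dual"
  by (auto simp: complex_dual_def scaleC_bcontfun.rep_eq
      intro!: bounded_linear_intro[where K = 1] norm_bounded)

lemma topspace_weak_topology [simp]: "topspace weak_topology = UNIV"
proof -
  have "UNIV \<in> {\<phi> -` U | \<phi> (U :: complex set). \<phi> \<in> complex_dual \<and> open U}"
    by (intro CollectI exI[of _ "\<lambda>_. 0"] exI[of _ UNIV]) (simp add: zero_in_complex_dual)
  then show ?thesis
    unfolding weak_topology_def topology_generated_by_topspace by blast
qed

lemma continuous_map_complex_dual:
  assumes "\<phi> \<in> complex_dual"
  shows "continuous_map weak_topology euclidean \<phi>"
proof -
  have "openin weak_topology (\<phi> -` U)" if "open U" for U
    unfolding weak_topology_def using assms that by (intro topology_generated_by_Basis) auto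
  then show ?thesis
    by (simp add: continuous_map_def vimage_def)
qed

lemma continuous_map_into_weak_topology:
  fixes u :: "'x \<Rightarrow> ('a::topological_space \<Rightarrow>\<^sub>C complex)"
  assumes "\<And>\<phi>. \<phi> \<in> complex_dual \<Longrightarrow> continuous_map X euclidean (\<lambda>x. \<phi> (u x))"
  shows "continuous_map X weak_topology u"
  unfolding weak_topology_def
proof (rule continuous_on_generated_topo)
  fix V :: "('a \<Rightarrow>\<^sub>C complex) set"
  assume "V \<in> {\<phi> -` U | \<phi> U. \<phi> \<in> complex_dual \<and> open (U :: complex set)}"
  then obtain \<phi> and U :: "complex set" where V: "V = \<phi> -` U" "\<phi> \<in> complex_dual" "open U"
    by blast
  have "u -` V \<inter> topspace X = {x \<in> topspace X. \<phi> (u x) \<in> U}"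
    using V(1) by auto
  then show "openin X (u -` V \<inter> topspace X)"
    using openin_continuous_map_preimage[OF assms[OF V(2)]] V(3) by simp
next
  show "u ` topspace X \<subseteq> \<Union> {\<phi> -` U | \<phi> U. \<phi> \<in> complex_dual \<and> open (U :: complex set)}"
    unfolding topspace_weak_topology[unfolded weak_topology_def topology_generated_by_topspace]
    by (rule subset_UNIV)
qed

lemma continuous_map_weak_topology_pointwise:
  "continuous_map weak_topology (product_topology (\<lambda>_. euclidean) UNIV) apply_bcontfun"
  by (auto simp: continuous_map_componentwise_UNIV
      intro: continuous_map_complex_dual apply_in_complex_dual)

lemma Hausdorff_weak_topology: "Hausdorff_space weak_topology"
  by (rule Hausdorff_space_injective_preimage[OF _ continuous_map_weak_topology_pointwise])
    (auto simp: Hausdorff_space_product_topology inj_on_def apply_bcontfun_inject)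

lemma apply_left_translate [simp]: "apply_bcontfun (left_translate s f) t = apply_bcontfun f (s * t)"
  by (simp add: left_translate.rep_eq)

text \<open>The weak topology is Hausdorff, so \<open>C\<close> is closed and the orbit closure is a
  closed subset of it.\<close>

lemma WAP_if_orbit_in_compact:
  assumes "compactin weak_topology C" and "\<And>s. left_translate s f \<in> C"
  shows "f \<in> WAP"
proof -
  have "closedin weak_topology C"
    using assms(1) Hausdorff_weak_topology compactin_imp_closedin by blast
  then have "weak_topology closure_of range (\<lambda>s. left_translate s f) \<subseteq> C"
    using assms(2) by (intro closure_of_minimal) auto
  then have "compactin weak_topology (weak_topology closure_of range (\<lambda>s. left_translate s f))"
    using closed_compactin[OF assms(1) _ closedin_closure_of] by blast
  then show ?thesis
    by (simp add: WAP_def)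
qed

lemma continuous_map_complex_iff:
  "continuous_map X euclidean f \<longleftrightarrow>
     continuous_map X euclidean (\<lambda>x. Re (f x)) \<and> continuous_map X euclidean (\<lambda>x. Im (f x))"
  by (auto simp: continuous_map_atin tendsto_complex_iff)

lemma continuous_map_complex_mult:
  fixes f g :: "'x \<Rightarrow> complex"
  assumes "continuous_map X euclidean f" and "continuous_map X euclidean g"
  shows "continuous_map X euclidean (\<lambda>x. f x * g x)"
  using assms by (simp add: continuous_map_atin tendsto_mult)

text \<open>The hypotheses of the fixed point property together with a base point, whose orbit
  transports functions on \<open>K\<close> to the semigroup.\<close>

locale quasi_equicontinuous_action =
  fixes K :: "'k topology" and T :: "'a::semitopological_semigroup \<Rightarrow> 'k \<Rightarrow> 'k" and x0 :: 'k
  assumes compact: "compact_space K" and hausdorff: "Hausdorff_space K"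
    and rep: "representation K T" and sep: "separately_continuous K T"
    and quasi: "quasi_equicontinuous K T"
    and x0: "x0 \<in> topspace K"
begin

definition orbit_fun :: "('k \<Rightarrow> complex) \<Rightarrow> ('a \<Rightarrow>\<^sub>C complex)" where
  "orbit_fun h = Bcontfun (\<lambda>t. h (T t x0))"

lemma bounded_on_space:
  fixes h :: "'k \<Rightarrow> complex"
  assumes "continuous_map K euclidean h"
  obtains C where "\<And>x. x \<in> topspace K \<Longrightarrow> norm (h x) \<le> C"
proof -
  have "compactin euclidean (h ` topspace K)"
    using image_compactin[OF _ assms] compact by (simp add: compact_space_def)
  then have "bounded (h ` topspace K)"
    by (simp add: compact_imp_bounded)
  then show thesis
    using that unfolding bounded_iff by blast
qed

lemma in_space: "x \<in> topspace K \<Longrightarrow> T s x \<in> topspace K"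
  using rep by (auto simp: representation_def)

lemma continuous_orbit: "continuous_map euclidean K (\<lambda>s. T s x0)"
  using sep x0 by (auto simp: separately_continuous_def)

lemma apply_orbit_fun [simp]:
  assumes "continuous_map K euclidean h"
  shows "apply_bcontfun (orbit_fun h) t = h (T t x0)"
proof -
  obtain C where C: "\<And>x. x \<in> topspace K \<Longrightarrow> norm (h x) \<le> C"
    using bounded_on_space[OF assms] by blast
  have "(\<lambda>t. h (T t x0)) \<in> bcontfun"
  proof (rule bcontfun_normI)
    show "continuous_on UNIV (\<lambda>t. h (T t x0))"
      using continuous_map_compose[OF continuous_orbit assms] by (simp add: o_def)
  qed (use C in_space x0 in blast)
  then show ?thesis
    by (simp add: orbit_fun_def Bcontfun_inverse)
qed

text \<open>This is T (s * t) x0 = T s (T t x0) read through \<open>h\<close>: left translation on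
  the semigroup becomes composition with \<open>T s\<close> on \<open>K\<close>.\<close>

lemma left_translate_orbit_fun:
  assumes "continuous_map K euclidean h"
  shows "left_translate s (orbit_fun h) = orbit_fun (\<lambda>x. h (T s x))"
proof -
  have "continuous_map K euclidean (\<lambda>x. h (T s x))"
    using continuous_map_compose[OF _ assms, of K "T s"] sep
    by (simp add: separately_continuous_def o_def)
  then show ?thesis
    using rep x0 by (intro bcontfun_eqI) (simp add: assms representation_def)
qed

text \<open>The closure \<open>E\<close> of the action is compact by Tychonoff and consists of
  continuous maps by quasi-equicontinuity. So (g, x) \<mapsto> h (g x) is separately continuous on E
  \<times> K, and \<open>\<Phi>\<close> maps \<open>E\<close> continuously onto a weakly compact set
  containing the orbit of \<open>orbit_fun h\<close>.\<close>

lemma orbit_fun_in_WAP: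
  assumes h: "continuous_map K euclidean h"
  shows "orbit_fun h \<in> WAP"
proof -
  define P where "P = product_topology (\<lambda>_. K) (topspace K)"
  define E where "E = P closure_of range (\<lambda>s. restrict (T s) (topspace K))"
  define \<Phi> where "\<Phi> g = Bcontfun (\<lambda>t. h (g (T t x0)))" for g
  have E: "continuous_map K K g" if "g \<in> E" for g
    using quasi that by (simp add: quasi_equicontinuous_def E_def P_def)
  have topspace_E: "topspace (subtopology P E) = E"
    using closure_of_subset_topspace[of P] by (auto simp: E_def)
  have compact_E: "compact_space (subtopology P E)"
    unfolding E_def P_def
    by (intro compact_space_subtopology closedin_compact_space)
      (auto simp: compact_space_product_topology compact)
  obtain C where C: "\<And>x. x \<in> topspace K \<Longrightarrow> norm (h x) \<le> C"
    using bounded_on_space[OF h] by blast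
  have real_part: "continuous_map (subtopology P E) euclidean (\<lambda>g. \<rho> (\<Phi> g))"
    if "bounded_linear \<rho>" for \<rho> :: "('a \<Rightarrow>\<^sub>C complex) \<Rightarrow> real"
    unfolding \<Phi>_def
  proof (rule continuous_map_functional_separately_continuous
      [OF that compact_E compact, where H = "\<lambda>g x. h (g x)" and C = C])
    show "continuous_map (subtopology P E) euclidean (\<lambda>g. h (g x))" if "x \<in> topspace K" for x
    proof -
      have "continuous_map P K (\<lambda>g. g x)"
        unfolding P_def using that by (rule continuous_map_product_projection)
      from continuous_map_compose[OF continuous_map_from_subtopology[OF this] h] show ?thesis
        by (simp add: o_def)
    qed
    show "continuous_map K euclidean (\<lambda>x. h (g x))" if "g \<in> topspace (subtopology P E)" for g
      using continuous_map_compose[OF E h, of g] that by (simp add: o_def topspace_E)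
    show "norm (h (g x)) \<le> C" if "g \<in> topspace (subtopology P E)" "x \<in> topspace K" for g x
      using E[of g] that C by (auto simp: topspace_E continuous_map_def)
  qed (rule continuous_orbit)
  have "continuous_map (subtopology P E) weak_topology \<Phi>"
  proof (rule continuous_map_into_weak_topology)
    fix \<phi> :: "('a \<Rightarrow>\<^sub>C complex) \<Rightarrow> complex"
    assume "\<phi> \<in> complex_dual"
    then have "bounded_linear \<phi>"
      by (simp add: complex_dual_def)
    then have "bounded_linear (\<lambda>f. Re (\<phi> f))" "bounded_linear (\<lambda>f. Im (\<phi> f))"
      by (auto intro: bounded_linear_compose[OF bounded_linear_Re] bounded_linear_compose[OF bounded_linear_Im])
    then show "continuous_map (subtopology P E) euclidean (\<lambda>g. \<phi> (\<Phi> g))"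
      unfolding continuous_map_complex_iff[of _ "\<lambda>g. \<phi> (\<Phi> g)"] using real_part by blast
  qed
  then have "compactin weak_topology (\<Phi> ` E)"
    using image_compactin[of "subtopology P E" E weak_topology \<Phi>] compact_E
    unfolding compact_space_def topspace_E by blast
  moreover have "left_translate s (orbit_fun h) \<in> \<Phi> ` E" for s
  proof (rule image_eqI)
    have "range (\<lambda>s. restrict (T s) (topspace K)) \<subseteq> topspace P"
      using in_space by (auto simp: P_def)
    then show "restrict (T s) (topspace K) \<in> E"
      unfolding E_def using closure_of_subset by blast
    show "left_translate s (orbit_fun h) = \<Phi> (restrict (T s) (topspace K))"
      unfolding left_translate_orbit_fun[OF h] by (simp add: orbit_fun_def \<Phi>_def in_space x0)
  qed
  ultimately show ?thesis
    by (rule WAP_if_orbit_in_compact)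
qed

text \<open>The compactness argument for characters of C(K). If no point works, every
  \<open>x\<close> has a nonnegative kernel element positive near \<open>x\<close>; a finite sum of
  these is a kernel element without zeros on \<open>K\<close>, hence invertible, contradicting \<mu>
  1 = 1.\<close>

lemma multiplicative_mean_is_evaluation:
  fixes m :: "('a \<Rightarrow>\<^sub>C complex) \<Rightarrow> complex"
  assumes "is_mean m" and "multiplicative m"
  obtains x where "x \<in> topspace K"
    and "\<And>h. continuous_map K euclidean h \<Longrightarrow> m (orbit_fun h) = h x"
proof -
  define \<mu> where "\<mu> h = m (orbit_fun h)" for h
  have add: "\<mu> (\<lambda>x. f x + g x) = \<mu> f + \<mu> g"
    and mult: "\<mu> (\<lambda>x. f x * g x) = \<mu> f * \<mu> g"
    if "continuous_map K euclidean f" "continuous_map K euclidean g" for f g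
  proof -
    have "orbit_fun (\<lambda>x. f x + g x) = orbit_fun f + orbit_fun g"
      by (rule bcontfun_eqI) (simp add: that continuous_map_add)
    then show "\<mu> (\<lambda>x. f x + g x) = \<mu> f + \<mu> g"
      using assms(1) orbit_fun_in_WAP[OF that(1)] orbit_fun_in_WAP[OF that(2)]
      by (simp add: \<mu>_def is_mean_def linear_on_WAP_def)
    have "orbit_fun (\<lambda>x. f x * g x) = mult_bcontfun (orbit_fun f) (orbit_fun g)"
      by (rule bcontfun_eqI) (simp add: that continuous_map_complex_mult mult_bcontfun.rep_eq)
    then show "\<mu> (\<lambda>x. f x * g x) = \<mu> f * \<mu> g"
      using assms(2) orbit_fun_in_WAP[OF that(1)] orbit_fun_in_WAP[OF that(2)]
      by (simp add: \<mu>_def multiplicative_def)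
  qed
  have one: "\<mu> (\<lambda>_. 1) = 1"
  proof -
    have "orbit_fun (\<lambda>_. 1) = const_bcontfun 1"
      by (rule bcontfun_eqI) simp
    then show ?thesis
      using assms(1) by (simp add: \<mu>_def is_mean_def)
  qed
  have const: "\<mu> (\<lambda>_. c) = c" for c
  proof -
    have "orbit_fun (\<lambda>_. c) = scaleC_bcontfun c (orbit_fun (\<lambda>_. 1))"
      by (rule bcontfun_eqI) (simp add: scaleC_bcontfun.rep_eq)
    moreover have "orbit_fun (\<lambda>_. 1) \<in> WAP"
      by (rule orbit_fun_in_WAP) simp
    ultimately have "\<mu> (\<lambda>_. c) = c * \<mu> (\<lambda>_. 1)"
      using assms(1) by (simp add: \<mu>_def is_mean_def linear_on_WAP_def)
    with one show ?thesis by simp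
  qed
  have "\<exists>x\<in>topspace K. \<forall>h. continuous_map K euclidean h \<longrightarrow> \<mu> h = h x"
  proof (rule ccontr)
    assume "\<not> ?thesis"
    then obtain h where h: "\<And>x. x \<in> topspace K \<Longrightarrow> continuous_map K euclidean (h x)"
      "\<And>x. x \<in> topspace K \<Longrightarrow> \<mu> (h x) \<noteq> h x x"
      by metis
    define r where "r x y = (cmod (h x y - \<mu> (h x)))\<^sup>2" for x y
    have r_cont: "continuous_map K euclideanreal (r x)" if "x \<in> topspace K" for x
      unfolding r_def using h(1)[OF that] by (intro continuous_intros) auto
    have of_real_cont: "continuous_map K euclidean (\<lambda>y. complex_of_real (u y))"
      if "continuous_map K euclideanreal u" for u
      using that by (simp add: continuous_map_complex_iff)
    have \<mu>_r: "\<mu> (\<lambda>y. of_real (r x y)) = 0" if "x \<in> topspace K" for x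
    proof -
      have d: "continuous_map K euclidean (\<lambda>y. h x y + - \<mu> (h x))"
        using h(1)[OF that] by (intro continuous_intros) auto
      then have cd: "continuous_map K euclidean (\<lambda>y. cnj (h x y + - \<mu> (h x)))"
        using continuous_map_compose[OF d, of euclidean cnj] by (simp add: o_def continuous_on_cnj)
      \<comment> \<open>Writing the squared modulus as a product exhibits \<open>r x\<close> as a
        multiple of h x - \<mu> (h x), which lies in the kernel.\<close>
      have "complex_of_real (r x y) = (h x y + - \<mu> (h x)) * cnj (h x y + - \<mu> (h x))" for y
        using complex_norm_square[of "h x y - \<mu> (h x)"] by (simp only: r_def of_real_power diff_conv_add_uminus)
      then have "\<mu> (\<lambda>y. of_real (r x y)) = \<mu> (\<lambda>y. (h x y + - \<mu> (h x)) * cnj (h x y + - \<mu> (h x)))"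
        by (simp only:)
      also have "\<dots> = \<mu> (\<lambda>y. h x y + - \<mu> (h x)) * \<mu> (\<lambda>y. cnj (h x y + - \<mu> (h x)))"
        by (rule mult[OF d cd])
      also have "\<mu> (\<lambda>y. h x y + - \<mu> (h x)) = 0"
        using add[OF h(1)[OF that], of "\<lambda>_. - \<mu> (h x)"] by (simp add: const)
      finally show ?thesis by simp
    qed
    define U where "U x = {y \<in> topspace K. r x y \<in> {0<..}}" for x
    have "openin K (U x)" if "x \<in> topspace K" for x
      unfolding U_def by (rule openin_continuous_map_preimage[OF r_cont[OF that]]) auto
    moreover have "topspace K \<subseteq> \<Union> (U ` topspace K)"
      using h(2) by (force simp: U_def r_def)
    ultimately obtain F where F: "finite F" "F \<subseteq> U ` topspace K" "topspace K \<subseteq> \<Union> F"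
      using compact unfolding compact_space_alt by (metis (no_types, lifting) image_iff)
    then obtain Q where Q: "finite Q" "Q \<subseteq> topspace K" "F = U ` Q"
      by (meson finite_subset_image)
    define R where "R y = (\<Sum>x\<in>Q. r x y)" for y
    have R_pos: "0 < R y" if y: "y \<in> topspace K" for y
    proof -
      obtain x where "x \<in> Q" "0 < r x y"
        using F(3) Q(3) y by (auto simp: U_def)
      then show ?thesis
        unfolding R_def using Q(1) by (intro sum_pos2) (auto simp: r_def)
    qed
    have R_cont: "continuous_map K euclideanreal R"
      unfolding R_def using Q r_cont by (intro continuous_intros) auto
    have "\<mu> (\<lambda>y. of_real (\<Sum>x\<in>Q. r x y)) = 0"
      using Q(1,2)
    proof (induction rule: finite_induct)
      case empty
      show ?case by (simp add: const)
    next
      case (insert x Q)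
      have "continuous_map K euclideanreal (\<lambda>y. \<Sum>x\<in>Q. r x y)"
        using insert.prems insert.hyps(1) r_cont by (intro continuous_intros) auto
      then have "\<mu> (\<lambda>y. of_real (r x y) + of_real (\<Sum>x\<in>Q. r x y)) =
          \<mu> (\<lambda>y. of_real (r x y)) + \<mu> (\<lambda>y. of_real (\<Sum>x\<in>Q. r x y))"
        using insert.prems by (intro add of_real_cont r_cont) auto
      with insert show ?case
        by (simp add: \<mu>_r)
    qed
    then have \<mu>_R: "\<mu> (\<lambda>y. of_real (R y)) = 0"
      by (simp add: R_def)
    \<comment> \<open>\<open>R\<close> is known to be positive only on \<open>K\<close>, so the
      orbit functions are compared rather than the functions themselves.\<close>
    have "orbit_fun (\<lambda>y. of_real (R y) * of_real (1 / R y)) = orbit_fun (\<lambda>_. 1)"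
      unfolding orbit_fun_def using R_pos[OF in_space[OF x0]]
      by (intro arg_cong[where f = Bcontfun] ext) (simp add: less_imp_neq[symmetric])
    then have "1 = \<mu> (\<lambda>y. of_real (R y) * of_real (1 / R y))"
      using one by (simp add: \<mu>_def)
    also have "\<dots> = \<mu> (\<lambda>y. of_real (R y)) * \<mu> (\<lambda>y. of_real (1 / R y))"
      using R_pos by (intro mult of_real_cont R_cont continuous_map_real_divide) force+
    finally show False
      using \<mu>_R by simp
  qed
  then show thesis
    using that by (auto simp: \<mu>_def)
qed

text \<open>Left invariance makes every continuous function agree at \<open>x\<close> and
  \<open>T s x\<close>, and by Urysohn's lemma such functions separate the points of
  \<open>K\<close>.\<close>

lemma common_fixed_point:
  fixes m :: "('a \<Rightarrow>\<^sub>C complex) \<Rightarrow> complex"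
  assumes "is_mean m" and "multiplicative m" and "left_invariant m"
  shows "\<exists>x\<in>topspace K. \<forall>s. T s x = x"
proof -
  obtain x where x: "x \<in> topspace K"
    and eval: "\<And>h. continuous_map K euclidean h \<Longrightarrow> m (orbit_fun h) = h x"
    using multiplicative_mean_is_evaluation[OF assms(1,2)] by blast
  have inv: "h (T s x) = h x" if h: "continuous_map K euclidean h" for h :: "'k \<Rightarrow> complex" and s
  proof -
    have "continuous_map K euclidean (\<lambda>x. h (T s x))"
      using continuous_map_compose[OF _ h, of K "T s"] sep
      by (simp add: separately_continuous_def o_def)
    then have "h (T s x) = m (left_translate s (orbit_fun h))"
      by (simp add: left_translate_orbit_fun[OF h] eval)
    also have "\<dots> = h x"
      using assms(3) orbit_fun_in_WAP[OF h] by (simp add: left_invariant_def eval h)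
    finally show ?thesis .
  qed
  have "T s x = x" for s
  proof (rule ccontr)
    assume neq: "T s x \<noteq> x"
    have "normal_space K"
      using compact hausdorff compact_Hausdorff_or_regular_imp_normal_space by blast
    moreover have "closedin K {T s x}" "closedin K {x}"
      using hausdorff x in_space by (auto intro: closedin_Hausdorff_singleton)
    moreover have "disjnt {T s x} {x}"
      using neq by simp
    ultimately obtain f where f: "continuous_map K (top_of_set {0..1::real}) f"
      "f ` {T s x} \<subseteq> {0}" "f ` {x} \<subseteq> {1}"
      using Urysohn_lemma[of K "{T s x}" "{x}" 0 1] by auto
    then have "continuous_map K euclideanreal f"
      by (simp add: continuous_map_in_subtopology)
    then have "continuous_map K euclidean (\<lambda>y. complex_of_real (f y))"
      by (simp add: continuous_map_complex_iff)
    from inv[OF this] f(2,3) show False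
      by simp
  qed
  with x show ?thesis by blast
qed

end

lemma fixed_point_property_if_mean:
  fixes m :: "('a::semitopological_semigroup \<Rightarrow>\<^sub>C complex) \<Rightarrow> complex"
  assumes "is_mean m" and "multiplicative m" and "left_invariant m"
  shows "fixed_point_property TYPE('a) TYPE('k)"
  unfolding fixed_point_property_def
proof (intro allI impI)
  fix K :: "'k topology" and T :: "'a \<Rightarrow> 'k \<Rightarrow> 'k"
  assume *: "compact_space K \<and> Hausdorff_space K \<and> topspace K \<noteq> {} \<and> representation K T \<and>
    separately_continuous K T \<and> quasi_equicontinuous K T"
  then obtain x0 where "x0 \<in> topspace K"
    by blast
  with * interpret quasi_equicontinuous_action K T x0
    by unfold_locales auto
  show "\<exists>x\<in>topspace K. \<forall>s. T s x = x"
    by (rule common_fixed_point[OF assms])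
qed

section \<open>The mean obtained from a fixed point\<close>

abbreviation WAP_orbit_closure ::
  "('a::semitopological_semigroup \<Rightarrow>\<^sub>C complex) \<Rightarrow> ('a \<Rightarrow>\<^sub>C complex) set" where
  "WAP_orbit_closure f \<equiv> weak_topology closure_of range (\<lambda>s. left_translate s f)"

lemma left_translate_in_orbit_closure: "left_translate s f \<in> WAP_orbit_closure f"
  using closure_of_subset[of "range (\<lambda>s. left_translate s f)" weak_topology] by auto

lemma compactin_orbit_closure: "f \<in> WAP \<Longrightarrow> compactin weak_topology (WAP_orbit_closure f)"
  by (simp add: WAP_def)

text \<open>The order is reversed; passing to the transposed maps on functionals reverses it again
  and gives a representation.\<close>

lemma left_translate_left_translate: "left_translate s (left_translate u f) = left_translate (u * s) f"
  by (rule bcontfun_eqI) (simp add: mult.assoc)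

lemma complex_dual_left_translate:
  assumes "\<phi> \<in> complex_dual"
  shows "(\<lambda>f. \<phi> (left_translate s f)) \<in> complex_dual"
proof -
  have "bounded_linear (left_translate s)"
  proof (rule bounded_linear_intro[where K = 1])
    show "norm (left_translate s f) \<le> norm f * 1" for f
      by (rule norm_bound) (simp add: norm_bounded)
  qed (auto intro: bcontfun_eqI)
  moreover have "left_translate s (scaleC_bcontfun c f) = scaleC_bcontfun c (left_translate s f)" for c f
    by (rule bcontfun_eqI) (simp add: scaleC_bcontfun.rep_eq)
  ultimately show ?thesis
    using assms by (simp add: complex_dual_def bounded_linear_compose)
qed

text \<open>Left translation is weakly continuous and maps the orbit of \<open>f\<close> into
  itself, so it preserves the compact orbit closure, which thus contains the orbit of each of its
  members.\<close>

lemma orbit_closure_subset_WAP: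
  assumes "f \<in> WAP"
  shows "WAP_orbit_closure f \<subseteq> WAP"
proof
  fix h assume h: "h \<in> WAP_orbit_closure f"
  show "h \<in> WAP"
  proof (rule WAP_if_orbit_in_compact[OF compactin_orbit_closure[OF assms]])
    fix s :: 'a
    have "continuous_map weak_topology weak_topology (left_translate s)"
      by (intro continuous_map_into_weak_topology continuous_map_complex_dual complex_dual_left_translate)
    then have "left_translate s h \<in> weak_topology closure_of (left_translate s ` range (\<lambda>u. left_translate u f))"
      using h continuous_map_image_closure_subset by blast
    also have "\<dots> \<subseteq> WAP_orbit_closure f"
      by (rule closure_of_mono) (auto simp: left_translate_left_translate)
    finally show "left_translate s h \<in> WAP_orbit_closure f" .
  qed
qed

lemma left_translate_in_WAP: "f \<in> WAP \<Longrightarrow> left_translate s f \<in> WAP"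
  using orbit_closure_subset_WAP left_translate_in_orbit_closure by blast

lemma const_in_WAP: "const_bcontfun c \<in> WAP"
proof (rule WAP_if_orbit_in_compact)
  show "compactin weak_topology {const_bcontfun c}"
    by simp
  show "left_translate s (const_bcontfun c) \<in> {const_bcontfun c}" for s
    by (auto intro: bcontfun_eqI)
qed

text \<open>On the weakly compact orbit closure the weak topology is the topology of pointwise convergence.\<close>

lemma continuous_left_translate_weak:
  fixes f :: "'a::semitopological_semigroup \<Rightarrow>\<^sub>C complex"
  assumes "f \<in> WAP" and "\<phi> \<in> complex_dual"
  shows "continuous_map euclidean euclidean (\<lambda>s. \<phi> (left_translate s f))"
proof -
  let ?P = "product_topology (\<lambda>_. euclidean) UNIV :: ('a \<Rightarrow> complex) topology"
  have trans: "continuous_map euclidean ?P (\<lambda>s. apply_bcontfun (left_translate s f))"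
    unfolding continuous_map_componentwise_UNIV
  proof
    show "continuous_map euclidean euclidean (\<lambda>s. apply_bcontfun (left_translate s f) t)" for t
      using continuous_on_compose2[OF _ continuous_on_right_mult subset_UNIV, of "apply_bcontfun f" t]
      by simp
  qed
  have "closedin euclidean {s. \<phi> (left_translate s f) \<in> C}" if "closed C" for C
  proof -
    \<comment> \<open>\<open>R\<close> is weakly compact, so its image is compact and hence closed
      for pointwise convergence. The preimage of this image under the pointwise continuous orbit map
      is the set in question, as \<open>apply_bcontfun\<close> is injective.\<close>
    define R where "R = WAP_orbit_closure f \<inter> {h \<in> topspace weak_topology. \<phi> h \<in> C}"
    have "closedin weak_topology {h \<in> topspace weak_topology. \<phi> h \<in> C}"
      using that by (intro closedin_continuous_map_preimage[OF continuous_map_complex_dual[OF assms(2)]]) simp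
    then have "compactin weak_topology R"
      unfolding R_def by (rule compact_Int_closedin[OF compactin_orbit_closure[OF assms(1)]])
    then have "compactin ?P (apply_bcontfun ` R)"
      by (rule image_compactin[OF _ continuous_map_weak_topology_pointwise])
    then have "closedin ?P (apply_bcontfun ` R)"
      by (intro compactin_imp_closedin) (simp_all add: Hausdorff_space_product_topology)
    then have "closedin euclidean {s \<in> topspace euclidean. apply_bcontfun (left_translate s f) \<in> apply_bcontfun ` R}"
      by (rule closedin_continuous_map_preimage[OF trans])
    moreover have "apply_bcontfun (left_translate s f) \<in> apply_bcontfun ` R \<longleftrightarrow> \<phi> (left_translate s f) \<in> C" for s
      using left_translate_in_orbit_closure[of s f]
      by (auto simp: R_def image_iff apply_bcontfun_inject)
    ultimately show ?thesis
      by simp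
  qed
  then show ?thesis
    by (simp add: continuous_map_closedin)
qed

section \<open>The closure of the point evaluations\<close>

definition evaluation_closure :: "(('a::topological_space \<Rightarrow>\<^sub>C complex) \<Rightarrow> complex) set" where
  "evaluation_closure =
     product_topology (\<lambda>_. euclidean) UNIV closure_of range (\<lambda>t f. apply_bcontfun f t)"

lemma evaluation_closure_eq:
  assumes "\<phi> \<in> evaluation_closure"
    and "continuous_map (product_topology (\<lambda>_. euclidean) UNIV) euclidean u"
    and "continuous_map (product_topology (\<lambda>_. euclidean) UNIV) euclidean v"
    and "\<And>t. u (\<lambda>f. apply_bcontfun f t) = (v (\<lambda>f. apply_bcontfun f t) :: complex)"
  shows "u \<phi> = v \<phi>"
  using assms forall_in_closure_of_eq[of \<phi> _ "range (\<lambda>t f. apply_bcontfun f t)" euclidean u v]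
  unfolding evaluation_closure_def by (auto simp: Hausdorff_space_euclidean)

text \<open>All of these hold for point evaluations and are closed conditions for pointwise
  convergence of functionals.\<close>

lemma evaluation_closure_props:
  assumes "\<phi> \<in> evaluation_closure"
  shows evaluation_closure_add: "\<phi> (f + g) = \<phi> f + \<phi> g"
    and evaluation_closure_scaleC: "\<phi> (scaleC_bcontfun c f) = c * \<phi> f"
    and evaluation_closure_mult: "\<phi> (mult_bcontfun f g) = \<phi> f * \<phi> g"
    and evaluation_closure_const: "\<phi> (const_bcontfun c) = c"
    and evaluation_closure_norm: "cmod (\<phi> f) \<le> norm f"
proof -
  let ?P = "product_topology (\<lambda>_. euclidean) UNIV :: (('a \<Rightarrow>\<^sub>C complex) \<Rightarrow> complex) topology"
  have proj [intro!]: "continuous_map ?P euclidean (\<lambda>\<phi>. \<phi> f)" for f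
    by (rule continuous_map_product_projection) simp
  show "\<phi> (f + g) = \<phi> f + \<phi> g"
    by (rule evaluation_closure_eq[OF assms]) (auto intro!: continuous_map_add)
  show "\<phi> (scaleC_bcontfun c f) = c * \<phi> f"
    by (rule evaluation_closure_eq[OF assms])
      (auto intro!: continuous_map_complex_mult simp: scaleC_bcontfun.rep_eq)
  show "\<phi> (mult_bcontfun f g) = \<phi> f * \<phi> g"
    by (rule evaluation_closure_eq[OF assms])
      (auto intro!: continuous_map_complex_mult simp: mult_bcontfun.rep_eq)
  show "\<phi> (const_bcontfun c) = c"
    by (rule evaluation_closure_eq[OF assms]) auto
  have "evaluation_closure \<subseteq> {\<phi> \<in> topspace ?P. cmod (\<phi> f) \<in> {..norm f}}"
    unfolding evaluation_closure_def
    by (rule closure_of_minimal, force intro: norm_bounded,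
        rule closedin_continuous_map_preimage[OF continuous_map_norm[OF proj]]) simp
  then show "cmod (\<phi> f) \<le> norm f"
    using assms by auto
qed

lemma evaluation_closure_subset_complex_dual: "evaluation_closure \<subseteq> complex_dual"
proof
  fix \<phi> :: "('a \<Rightarrow>\<^sub>C complex) \<Rightarrow> complex"
  assume \<phi>: "\<phi> \<in> evaluation_closure"
  have "\<phi> (r *\<^sub>R f) = r *\<^sub>R \<phi> f" for r f
  proof -
    have "r *\<^sub>R f = scaleC_bcontfun (of_real r) f"
      by (rule bcontfun_eqI) (simp add: scaleC_bcontfun.rep_eq scaleR_conv_of_real)
    then show ?thesis
      using evaluation_closure_scaleC[OF \<phi>] by (simp add: scaleR_conv_of_real)
  qed
  then have "bounded_linear \<phi>"
    using evaluation_closure_add[OF \<phi>] evaluation_closure_norm[OF \<phi>]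
    by (intro bounded_linear_intro[where K = 1]) auto
  then show "\<phi> \<in> complex_dual"
    using evaluation_closure_scaleC[OF \<phi>] by (simp add: complex_dual_def)
qed

lemma compactin_evaluation_closure:
  "compactin (product_topology (\<lambda>_. euclidean) UNIV)
     (evaluation_closure :: (('a::topological_space \<Rightarrow>\<^sub>C complex) \<Rightarrow> complex) set)"
proof (rule closed_compactin)
  show "compactin (product_topology (\<lambda>_. euclidean) UNIV)
      (Pi\<^sub>E UNIV (\<lambda>f :: 'a \<Rightarrow>\<^sub>C complex. cball (0 :: complex) (norm f)))"
    by (simp add: compactin_PiE)
  show "evaluation_closure \<subseteq> Pi\<^sub>E UNIV (\<lambda>f :: 'a \<Rightarrow>\<^sub>C complex. cball (0 :: complex) (norm f))"
    by (auto intro: evaluation_closure_norm)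
qed (simp add: evaluation_closure_def)

text \<open>The transpose of left translation by \<open>s\<close> sends evaluation at
  \<open>t\<close> to evaluation at \<open>s * t\<close> and is pointwise continuous.\<close>

lemma evaluation_closure_left_translate:
  assumes "\<phi> \<in> evaluation_closure"
  shows "(\<lambda>f. \<phi> (left_translate s f)) \<in> evaluation_closure"
proof -
  let ?P = "product_topology (\<lambda>_. euclidean) UNIV :: (('a \<Rightarrow>\<^sub>C complex) \<Rightarrow> complex) topology"
  have "continuous_map ?P ?P (\<lambda>\<phi> f. \<phi> (left_translate s f))"
    unfolding continuous_map_componentwise_UNIV by (auto intro: continuous_map_product_projection)
  then have "(\<lambda>f. \<phi> (left_translate s f)) \<in>
      ?P closure_of ((\<lambda>\<phi> f. \<phi> (left_translate s f)) ` range (\<lambda>t f. apply_bcontfun f t))"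
    using assms continuous_map_image_closure_subset unfolding evaluation_closure_def by blast
  also have "\<dots> \<subseteq> evaluation_closure"
    unfolding evaluation_closure_def by (rule closure_of_mono) auto
  finally show ?thesis .
qed

text \<open>
  Restricting the closure of the evaluations, rather than taking all characters of
  \<^const>\<open>WAP\<close>, makes every point extend to a functional in \<^const>\<open>complex_dual\<close>
  without the Hahn-Banach theorem.
\<close>

definition WAP_space :: "(('a::semitopological_semigroup \<Rightarrow>\<^sub>C complex) \<Rightarrow> complex) topology" where
  "WAP_space = subtopology (product_topology (\<lambda>_. euclidean) WAP)
     ((\<lambda>\<phi>. restrict \<phi> WAP) ` evaluation_closure)"

definition WAP_action ::
  "'a::semitopological_semigroup \<Rightarrow> (('a \<Rightarrow>\<^sub>C complex) \<Rightarrow> complex) \<Rightarrow> (('a \<Rightarrow>\<^sub>C complex) \<Rightarrow> complex)" where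
  "WAP_action s \<phi> = restrict (\<lambda>f. \<phi> (left_translate s f)) WAP"

lemma topspace_WAP_space: "topspace WAP_space = (\<lambda>\<phi>. restrict \<phi> WAP) ` evaluation_closure"
  by (auto simp: WAP_space_def)

lemma WAP_space_extends:
  assumes "x \<in> topspace WAP_space"
  obtains \<phi> where "\<phi> \<in> evaluation_closure" and "x = restrict \<phi> WAP"
  using assms by (auto simp: topspace_WAP_space)

lemma continuous_map_WAP_space_apply:
  assumes "f \<in> WAP"
  shows "continuous_map WAP_space euclidean (\<lambda>x. x f)"
  unfolding WAP_space_def
  by (intro continuous_map_from_subtopology continuous_map_product_projection assms)

lemma continuous_map_into_WAP_space:
  assumes "\<And>f. f \<in> WAP \<Longrightarrow> continuous_map X euclidean (\<lambda>y. u y f)"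
    and "\<And>y. y \<in> topspace X \<Longrightarrow> u y \<in> topspace WAP_space"
  shows "continuous_map X WAP_space u"
proof -
  have "u y \<in> extensional WAP" if "y \<in> topspace X" for y
    using assms(2)[OF that] by (auto simp: topspace_WAP_space)
  then show ?thesis
    unfolding WAP_space_def
    using assms by (intro continuous_map_into_subtopology)
      (auto simp: continuous_map_componentwise topspace_WAP_space)
qed

lemma compact_WAP_space: "compact_space WAP_space"
  unfolding WAP_space_def
proof (rule compact_space_subtopology[OF image_compactin[OF compactin_evaluation_closure]])
  show "continuous_map (product_topology (\<lambda>_. euclidean) UNIV)
      (product_topology (\<lambda>_. euclidean) WAP) (\<lambda>\<phi>. restrict \<phi> WAP)"
    unfolding continuous_map_componentwise by (auto intro: continuous_map_product_projection)
qed

lemma Hausdorff_WAP_space: "Hausdorff_space WAP_space"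
  unfolding WAP_space_def
  by (intro Hausdorff_space_subtopology) (simp add: Hausdorff_space_product_topology)

lemma topspace_WAP_space_nonempty: "topspace WAP_space \<noteq> {}"
  by (simp add: topspace_WAP_space evaluation_closure_def closure_of_eq_empty)

section \<open>The translation action and its continuity properties\<close>

lemma WAP_action_restrict:
  "WAP_action s (restrict \<phi> WAP) = restrict (\<lambda>f. \<phi> (left_translate s f)) WAP"
  by (auto simp: WAP_action_def restrict_def left_translate_in_WAP)

lemma WAP_action_in_space:
  assumes "x \<in> topspace WAP_space"
  shows "WAP_action s x \<in> topspace WAP_space"
proof -
  obtain \<phi> where "\<phi> \<in> evaluation_closure" "x = restrict \<phi> WAP"
    using assms by (rule WAP_space_extends)
  then show ?thesis
    using evaluation_closure_left_translate by (auto simp: topspace_WAP_space WAP_action_restrict)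
qed

lemma WAP_action_apply: "f \<in> WAP \<Longrightarrow> WAP_action s x f = x (left_translate s f)"
  by (simp add: WAP_action_def)

lemma representation_WAP_action: "representation WAP_space WAP_action"
  unfolding representation_def
proof (intro conjI allI ballI)
  show "WAP_action s \<in> topspace WAP_space \<rightarrow> topspace WAP_space" for s :: 'a
    using WAP_action_in_space by blast
  show "WAP_action (s * t) x = WAP_action s (WAP_action t x)" for s t :: 'a and x
    by (auto simp: WAP_action_def restrict_def left_translate_in_WAP left_translate_left_translate)
qed

text \<open>For fixed \<open>s\<close>, each coordinate of the action is again a coordinate
  projection. For fixed \<open>x\<close>, the extension of \<open>x\<close> in
  \<open>complex_dual\<close> reduces the claim to weak continuity of the orbit map.\<close>

lemma separately_continuous_WAP_action: "separately_continuous WAP_space WAP_action"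
  unfolding separately_continuous_def
proof (intro conjI allI ballI)
  show "continuous_map WAP_space WAP_space (WAP_action s)" for s :: 'a
    by (rule continuous_map_into_WAP_space)
      (simp_all add: WAP_action_in_space WAP_action_apply left_translate_in_WAP
        continuous_map_WAP_space_apply)
  fix x :: "('a \<Rightarrow>\<^sub>C complex) \<Rightarrow> complex"
  assume x: "x \<in> topspace WAP_space"
  then obtain \<phi> where \<phi>: "\<phi> \<in> evaluation_closure" "x = restrict \<phi> WAP"
    by (rule WAP_space_extends)
  show "continuous_map euclidean WAP_space (\<lambda>s. WAP_action s x)"
  proof (rule continuous_map_into_WAP_space)
    fix f :: "'a \<Rightarrow>\<^sub>C complex" assume f: "f \<in> WAP"
    have "continuous_map euclidean euclidean (\<lambda>s. \<phi> (left_translate s f))"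
      using \<phi>(1) evaluation_closure_subset_complex_dual
      by (intro continuous_left_translate_weak[OF f]) blast
    then show "continuous_map euclidean euclidean (\<lambda>s. WAP_action s x f)"
      using f by (simp add: WAP_action_apply \<phi>(2) left_translate_in_WAP)
  qed (rule WAP_action_in_space[OF x])
qed

text \<open>For each \<open>f\<close>, a limit \<open>g\<close> of translations has the form g x f =
  x h with a fixed \<open>h\<close> in WAP, so every coordinate of \<open>g\<close> is a coordinate
  projection.\<close>

lemma quasi_equicontinuous_WAP_action: "quasi_equicontinuous WAP_space WAP_action"
  unfolding quasi_equicontinuous_def
proof
  let ?X = "topspace WAP_space :: (('a \<Rightarrow>\<^sub>C complex) \<Rightarrow> complex) set"
  let ?P = "product_topology (\<lambda>_. WAP_space) ?X"
  let ?L = "product_topology (\<lambda>_. euclidean :: complex topology) ?X"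
  let ?A = "range (\<lambda>s. restrict (WAP_action s) ?X)"
  fix g assume g: "g \<in> ?P closure_of ?A"
  then have "g \<in> topspace ?P"
    by (rule in_closure_of[THEN iffD1, THEN conjunct1])
  then have g_in: "g x \<in> ?X" if "x \<in> ?X" for x
    using that by (auto simp: PiE_iff)
  \<comment> \<open>The coordinate \<open>f\<close> of \<open>g\<close> is evaluation at a weak cluster point of translates of \<open>f\<close>.\<close>
  have key: "\<exists>h\<in>WAP. \<forall>x\<in>?X. g x f = x h" if f: "f \<in> WAP" for f
  proof -
    \<comment> \<open>\<open>E\<close> reads off coordinate \<open>f\<close> of a self-map and sends
      translation by \<open>s\<close> to J (left_translate s f). Since \<open>J\<close> maps the
      weakly compact orbit closure to a closed set, \<open>E g\<close> remains in its image.\<close>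
    define J where "J h = restrict (\<lambda>x. x h) ?X" for h :: "'a \<Rightarrow>\<^sub>C complex"
    define E where "E q = restrict (\<lambda>x. q x f) ?X" for q :: "(('a \<Rightarrow>\<^sub>C complex) \<Rightarrow> complex) \<Rightarrow> (('a \<Rightarrow>\<^sub>C complex) \<Rightarrow> complex)"
    let ?Q = "WAP_orbit_closure f"
    have "continuous_map (subtopology weak_topology ?Q) ?L J"
      unfolding continuous_map_componentwise
    proof (intro conjI ballI)
      fix x assume x: "x \<in> ?X"
      then obtain \<phi> where \<phi>: "\<phi> \<in> evaluation_closure" "x = restrict \<phi> WAP"
        by (rule WAP_space_extends)
      have "continuous_map (subtopology weak_topology ?Q) euclidean \<phi>"
        using \<phi>(1) evaluation_closure_subset_complex_dual
        by (intro continuous_map_from_subtopology continuous_map_complex_dual) blast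
      then show "continuous_map (subtopology weak_topology ?Q) euclidean (\<lambda>h. J h x)"
        by (rule continuous_map_eq)
          (use x \<phi>(2) orbit_closure_subset_WAP[OF f] in \<open>auto simp: J_def\<close>)
    qed (auto simp: J_def)
    then have "compactin ?L (J ` ?Q)"
      by (rule image_compactin[rotated])
        (simp add: compactin_subtopology compactin_orbit_closure[OF f])
    then have closed: "closedin ?L (J ` ?Q)"
      by (intro compactin_imp_closedin) (simp_all add: Hausdorff_space_product_topology)
    have "continuous_map ?P ?L E"
      unfolding continuous_map_componentwise
    proof (intro conjI ballI)
      fix x assume x: "x \<in> ?X"
      have "continuous_map ?P WAP_space (\<lambda>q. q x)"
        using x by (rule continuous_map_product_projection)
      from continuous_map_compose[OF this continuous_map_WAP_space_apply[OF f]]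
      show "continuous_map ?P euclidean (\<lambda>q. E q x)"
        using x by (simp add: E_def o_def)
    qed (auto simp: E_def)
    then have "E g \<in> ?L closure_of (E ` ?A)"
      using g continuous_map_image_closure_subset by blast
    also have "E ` ?A \<subseteq> J ` ?Q"
    proof -
      have "E (restrict (WAP_action s) ?X) = J (left_translate s f)" for s
        by (auto simp: E_def J_def restrict_def WAP_action_apply[OF f])
      then show ?thesis
        using left_translate_in_orbit_closure by blast
    qed
    then have "?L closure_of (E ` ?A) \<subseteq> J ` ?Q"
      using closed by (rule closure_of_minimal)
    finally obtain h where h: "h \<in> ?Q" "E g = J h"
      by blast
    have "g x f = x h" if "x \<in> ?X" for x
      using fun_cong[OF h(2), of x] that by (simp add: E_def J_def)
    with h(1) show ?thesis
      using orbit_closure_subset_WAP[OF f] by blast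
  qed
  show "continuous_map WAP_space WAP_space g"
  proof (rule continuous_map_into_WAP_space)
    fix f :: "'a \<Rightarrow>\<^sub>C complex" assume "f \<in> WAP"
    then obtain h where h: "h \<in> WAP" "\<forall>x\<in>?X. g x f = x h"
      using key by blast
    show "continuous_map WAP_space euclidean (\<lambda>x. g x f)"
      by (rule continuous_map_eq[OF continuous_map_WAP_space_apply[OF h(1)]]) (use h(2) in auto)
  qed (rule g_in)
qed

lemma is_mean_evaluation_closure:
  fixes \<phi> :: "('a::semitopological_semigroup \<Rightarrow>\<^sub>C complex) \<Rightarrow> complex"
  assumes "\<phi> \<in> evaluation_closure"
  shows "is_mean \<phi>"
proof -
  let ?N = "{cmod (\<phi> f) | f. f \<in> WAP \<and> norm f \<le> 1}"
  have le: "r \<le> 1" if "r \<in> ?N" for r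
    using that evaluation_closure_norm[OF assms] by (auto intro: order_trans)
  have "norm (const_bcontfun 1 :: 'a \<Rightarrow>\<^sub>C complex) \<le> 1"
    by (rule norm_bound) simp
  then have "cmod (\<phi> (const_bcontfun 1)) \<in> ?N"
    using const_in_WAP by blast
  then have "1 \<in> ?N"
    by (simp add: evaluation_closure_const[OF assms])
  then have "Sup ?N = 1"
    using le by (rule cSup_eq_maximum)
  moreover have "bdd_above ?N"
    using le by (rule bdd_aboveI)
  ultimately show ?thesis
    using evaluation_closure_add[OF assms] evaluation_closure_scaleC[OF assms]
      evaluation_closure_const[OF assms]
    by (simp add: is_mean_def linear_on_WAP_def)
qed

text \<open>The fixed point is the restriction of some \<phi> in \<open>evaluation_closure\<close>.
  Such a \<phi> is always a multiplicative mean, and being fixed amounts to left invariance.\<close>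

lemma mean_if_fixed_point_property:
  assumes "fixed_point_property TYPE('a::semitopological_semigroup) TYPE(('a \<Rightarrow>\<^sub>C complex) \<Rightarrow> complex)"
  shows "\<exists>m :: ('a \<Rightarrow>\<^sub>C complex) \<Rightarrow> complex. is_mean m \<and> multiplicative m \<and> left_invariant m"
proof -
  have "\<exists>x\<in>topspace WAP_space. \<forall>s::'a. WAP_action s x = x"
    using assms compact_WAP_space Hausdorff_WAP_space topspace_WAP_space_nonempty
      representation_WAP_action separately_continuous_WAP_action quasi_equicontinuous_WAP_action
    unfolding fixed_point_property_def by blast
  then obtain \<phi> :: "('a \<Rightarrow>\<^sub>C complex) \<Rightarrow> complex" where \<phi>: "\<phi> \<in> evaluation_closure"
    and fixed: "\<And>s. WAP_action s (restrict \<phi> WAP) = restrict \<phi> WAP"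
    by (auto simp: topspace_WAP_space)
  have "\<phi> (left_translate s f) = \<phi> f" if "f \<in> WAP" for s f
    using fun_cong[OF fixed[of s], of f] that by (simp add: WAP_action_restrict)
  then have "left_invariant \<phi>"
    by (simp add: left_invariant_def)
  moreover have "multiplicative \<phi>"
    by (simp add: multiplicative_def evaluation_closure_mult[OF \<phi>])
  ultimately show ?thesis
    using is_mean_evaluation_closure[OF \<phi>] by blast
qed

text \<open>The first conjunct shows that spaces with points in the functional type suffice to
  produce a mean; the second gives the fixed point property for an arbitrary point type
  \<open>'k\<close>. Together they express the quantification over all compact Hausdorff
  spaces.\<close>

theorem theorem5p3:
  shows "((\<exists>m :: ('a::semitopological_semigroup \<Rightarrow>\<^sub>C complex) \<Rightarrow> complex.
             is_mean m \<and> multiplicative m \<and> left_invariant m)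
           \<longleftrightarrow> fixed_point_property TYPE('a) TYPE(('a \<Rightarrow>\<^sub>C complex) \<Rightarrow> complex))
       \<and> ((\<exists>m :: ('a \<Rightarrow>\<^sub>C complex) \<Rightarrow> complex.
             is_mean m \<and> multiplicative m \<and> left_invariant m)
           \<longrightarrow> fixed_point_property TYPE('a) TYPE('k))"
  by (intro conjI iffI impI; (elim exE conjE)?)
    (rule fixed_point_property_if_mean mean_if_fixed_point_property; assumption)+

end
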